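(* The slice regular Bergman kernel of the second kind for the half space $\mathbb H^+=\{q\in\mathbb H:\mathrm{Re}(q)>0\}$ is, for $q,r\in\mathbb H^+$, $$\mathcal K_{\mathbb H^+}(q,r)=\frac1\pi\,(\bar q^2+2\bar q\,\bar r+\bar r^2)\,(|q|^2+2\,\mathrm{Re}[q]\,\bar r+\bar r^2)^{-2}=\frac1\pi\,(q^2+2\,\mathrm{Re}[r]\,q+|r|^2)^{-2}\,(q^2+2qr+r^2).$$
   Context: $\mathbb H$ is the algebra of real quaternions, $\mathbb S^2$ is the set of purely imaginary quaternions of modulus $1$, and for $\mathbf i\in\mathbb S^2$, $\mathbb C(\mathbf i)=\{x+y\mathbf i: x,y\in\mathbb R\}$. For $\Omega\subseteq\mathbb H$ put $\Omega_{\mathbf i}=\Omega\cap\mathbb C(\mathbf i)$. $\mathcal{SR}(\Omega)$ is the set of (left) slice regular functions on the open set $\Omega$: real differentiable $f:\Omega\to\mathbb H$ such that for every $\mathbf i\in\mathbb S^2$, $\left(\frac{\partial}{\partial x}+\mathbf i\frac{\partial}{\partial y}\right)f|_{\Omega_{\mathbf i}}(x+y\mathbf i)=0$ on $\Omega_{\mathbf i}$. Let $\Omega=\mathbb H^+$. For $\mathbf j\in\mathbb S^2$, $\mathcal A(\Omega_{\mathbf j})=\{f\in\mathcal{SR}(\Omega): \int_{\Omega_{\mathbf j}}|f|^2d\sigma_{\mathbf j}<\infty\}$, with $d\sigma_{\mathbf j}(x+\mathbf j y)=dx\,dy$, is a quaternionic right Hilbert space with inner product $\langle f,g\rangle=\int_{\Omega_{\mathbf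 j}}\overline f\,g\,d\sigma_{\mathbf j}$. For $q\in\Omega_{\mathbf j}$ there is a unique $K_q(\mathbf j)\in\mathcal A(\Omega_{\mathbf j})$ with $f(q)=\langle K_q(\mathbf j),f\rangle$ for all $f\in\mathcal A(\Omega_{\mathbf j})$. Put $\mathcal K_{\Omega_{\mathbf j}}(q,r)=\overline{K_q(\mathbf j)(r)}$, $q,r\in\Omega_{\mathbf j}$. The slice Bergman kernel of the second kind $\mathcal K_\Omega:\Omega\times\Omega\to\mathbb H$ is the extension in the first variable: for $r\in\Omega$, choose $\mathbf j\in\mathbb S^2$ with $r\in\Omega_{\mathbf j}$, and for $q=x+y\mathbf i\in\Omega$ ($x,y\in\mathbb R$, $\mathbf i\in\mathbb S^2$) put $$\mathcal K_\Omega(x+y\mathbf i,r)=\tfrac12(1-\mathbf i\mathbf j)\,\mathcal K_{\Omega_{\mathbf j}}(x+y\mathbf j,r)+\tfrac12(1+\mathbf i\mathbf j)\,\mathcal K_{\Omega_{\mathbf j}}(x-y\mathbf j,r).$$ *)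

theory Defs
  imports "HOL-Analysis.Analysis"
begin

datatype quat = Quat (qRe: real) (qIm1: real) (qIm2: real) (qIm3: real)

lemma quat_eq_iff:
  "p = q \<longleftrightarrow> qRe p = qRe q \<and> qIm1 p = qIm1 q \<and> qIm2 p = qIm2 q \<and> qIm3 p = qIm3 q"
  by (cases p; cases q) auto

definition qcnj :: "quat \<Rightarrow> quat" where
  "qcnj q = Quat (qRe q) (- qIm1 q) (- qIm2 q) (- qIm3 q)"

instantiation quat :: real_div_algebra
begin

definition "0 = Quat 0 0 0 0"

definition "1 = Quat 1 0 0 0"

definition "p + q = Quat (qRe p + qRe q) (qIm1 p + qIm1 q) (qIm2 p + qIm2 q) (qIm3 p + qIm3 q)"

definition "- q = Quat (- qRe q) (- qIm1 q) (- qIm2 q) (- qIm3 q)"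

definition "p - q = Quat (qRe p - qRe q) (qIm1 p - qIm1 q) (qIm2 p - qIm2 q) (qIm3 p - qIm3 q)"

definition "p * q = Quat
  (qRe p * qRe q - qIm1 p * qIm1 q - qIm2 p * qIm2 q - qIm3 p * qIm3 q)
  (qRe p * qIm1 q + qIm1 p * qRe q + qIm2 p * qIm3 q - qIm3 p * qIm2 q)
  (qRe p * qIm2 q - qIm1 p * qIm3 q + qIm2 p * qRe q + qIm3 p * qIm1 q)
  (qRe p * qIm3 q + qIm1 p * qIm2 q - qIm2 p * qIm1 q + qIm3 p * qRe q)"

definition "c *\<^sub>R q = Quat (c * qRe q) (c * qIm1 q) (c * qIm2 q) (c * qIm3 q)"

definition "inverse q =
  inverse ((qRe q)\<^sup>2 + (qIm1 q)\<^sup>2 + (qIm2 q)\<^sup>2 + (qIm3 q)\<^sup>2) *\<^sub>R qcnj q"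

definition "p div (q :: quat) = p * inverse q"

instance
proof
  fix q :: quat
  assume "q \<noteq> 0"
  then have "(qRe q)\<^sup>2 + (qIm1 q)\<^sup>2 + (qIm2 q)\<^sup>2 + (qIm3 q)\<^sup>2 \<noteq> 0"
    by (auto simp: zero_quat_def quat_eq_iff add_nonneg_eq_0_iff)
  then obtain s where s: "inverse ((qRe q)\<^sup>2 + (qIm1 q)\<^sup>2 + (qIm2 q)\<^sup>2 + (qIm3 q)\<^sup>2) = s"
    "s * ((qRe q)\<^sup>2 + (qIm1 q)\<^sup>2 + (qIm2 q)\<^sup>2 + (qIm3 q)\<^sup>2) = 1"
    by (metis left_inverse)
  show "inverse q * q = 1" "q * inverse q = 1"
    unfolding inverse_quat_def s(1) using s(2)
    by (simp_all add: times_quat_def one_quat_def scaleR_quat_def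
        qcnj_def algebra_simps power2_eq_square)
qed (simp_all add: zero_quat_def one_quat_def plus_quat_def uminus_quat_def minus_quat_def
    times_quat_def scaleR_quat_def inverse_quat_def divide_quat_def qcnj_def quat_eq_iff
    algebra_simps)

end

instantiation quat :: real_inner
begin

definition "inner p q = qRe p * qRe q + qIm1 p * qIm1 q + qIm2 p * qIm2 q + qIm3 p * qIm3 q"

definition "norm q = sqrt ((qRe q)\<^sup>2 + (qIm1 q)\<^sup>2 + (qIm2 q)\<^sup>2 + (qIm3 q)\<^sup>2)"

definition "sgn (q :: quat) = q /\<^sub>R norm q"

definition "dist p (q :: quat) = norm (p - q)"

definition [code del]:
  "(uniformity :: (quat \<times> quat) filter) = (INF e\<in>{0 <..}. principal {(x, y). dist x y < e})"

definition [code del]: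
  "open (U :: quat set) \<longleftrightarrow> (\<forall>x\<in>U. eventually (\<lambda>(x', y). x' = x \<longrightarrow> y \<in> U) uniformity)"

instance
proof
  fix p q r :: quat and c :: real
  show "dist p q = norm (p - q)" "sgn q = q /\<^sub>R norm q"
    by (simp_all add: dist_quat_def sgn_quat_def)
  show "(uniformity :: (quat \<times> quat) filter) = (INF e\<in>{0 <..}. principal {(x, y). dist x y < e})"
    by (rule uniformity_quat_def)
  show "open U \<longleftrightarrow> (\<forall>x\<in>U. eventually (\<lambda>(x', y). x' = x \<longrightarrow> y \<in> U) uniformity)"
    for U :: "quat set"
    by (rule open_quat_def)
  show "inner p q = inner q p" "inner (p + q) r = inner p r + inner q r"
    "inner (c *\<^sub>R p) q = c * inner p q"
    by (simp_all add: inner_quat_def plus_quat_def scaleR_quat_def algebra_simps)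
  show "0 \<le> inner q q" "norm q = sqrt (inner q q)"
    by (simp_all add: inner_quat_def norm_quat_def power2_eq_square)
  show "inner q q = 0 \<longleftrightarrow> q = 0"
    by (auto simp: inner_quat_def zero_quat_def quat_eq_iff add_nonneg_eq_0_iff)
qed

end

instance quat :: real_normed_div_algebra
proof
  fix p q :: quat
  show "norm (p * q) = norm p * norm q"
    unfolding norm_quat_def real_sqrt_mult[symmetric]
    by (simp add: times_quat_def algebra_simps power2_eq_square)
qed

instantiation quat :: euclidean_space
begin

definition "Basis = {Quat 1 0 0 0, Quat 0 1 0 0, Quat 0 0 1 0, Quat 0 0 0 1}"

instance
proof
  fix u v q :: quat
  show "(Basis :: quat set) \<noteq> {}" "finite (Basis :: quat set)"
    by (simp_all add: Basis_quat_def)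
  show "inner u v = (if u = v then 1 else 0)" if "u \<in> Basis" "v \<in> Basis"
    using that unfolding Basis_quat_def
    by (elim insertE emptyE; simp only:) (simp_all add: inner_quat_def)
  show "(\<forall>u\<in>Basis. inner q u = 0) \<longleftrightarrow> q = 0"
    by (cases q) (simp add: Basis_quat_def inner_quat_def zero_quat_def)
qed

end

definition imag_unit_sphere :: "quat set" where
  "imag_unit_sphere = {q. qRe q = 0 \<and> norm q = 1}"

definition slice_point :: "quat \<Rightarrow> real \<Rightarrow> real \<Rightarrow> quat" where
  "slice_point i x y = of_real x + of_real y * i"

definition slice_plane :: "quat \<Rightarrow> quat set" where
  "slice_plane i = {slice_point i x y |x y. True}"

text \<open>
  Functions \<open>\<Omega> \<rightarrow> \<H>\<close> are represented by functions on all of \<^typ>\<open>quat\<close> that are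
  \<^const>\<open>extensional\<close> on \<open>\<Omega>\<close>, so that equality of the representing
  functions is equality on \<open>\<Omega>\<close>; this matters for the uniqueness in
  \<open>slice_bergman_rep\<close> below. The domain \<open>\<Omega>\<close> is meant to be open, hence the
  two-sided partial derivatives.
\<close>

definition slice_regular :: "quat set \<Rightarrow> (quat \<Rightarrow> quat) set" where
  "slice_regular \<Omega> = {f \<in> extensional \<Omega>. f differentiable_on \<Omega> \<and>
     (\<forall>i\<in>imag_unit_sphere. \<forall>x y. slice_point i x y \<in> \<Omega> \<longrightarrow>
        vector_derivative (\<lambda>t. f (slice_point i t y)) (at x)
        + i * vector_derivative (\<lambda>t. f (slice_point i x t)) (at y) = 0)}"

text \<open>\<open>d\<sigma>\<^sub>j = dx dy\<close>, as a measure on the quaternions concentrated on \<open>slice_plane j\<close>.\<close>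

definition slice_measure :: "quat \<Rightarrow> quat measure" where
  "slice_measure j = distr (lborel :: (real \<times> real) measure) borel (\<lambda>(x, y). slice_point j x y)"

definition slice_bergman_space :: "quat set \<Rightarrow> quat \<Rightarrow> (quat \<Rightarrow> quat) set" where
  "slice_bergman_space \<Omega> j =
     {f \<in> slice_regular \<Omega>.
        (\<integral>\<^sup>+q\<in>\<Omega> \<inter> slice_plane j. ennreal ((norm (f q))\<^sup>2) \<partial>slice_measure j) < \<infinity>}"

definition slice_inner :: "quat set \<Rightarrow> quat \<Rightarrow> (quat \<Rightarrow> quat) \<Rightarrow> (quat \<Rightarrow> quat) \<Rightarrow> quat" where
  "slice_inner \<Omega> j f g = (LINT q:\<Omega> \<inter> slice_plane j|slice_measure j. qcnj (f q) * g q)"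

definition slice_bergman_rep :: "quat set \<Rightarrow> quat \<Rightarrow> quat \<Rightarrow> quat \<Rightarrow> quat" where
  "slice_bergman_rep \<Omega> j q =
     (THE K. K \<in> slice_bergman_space \<Omega> j \<and>
        (\<forall>f\<in>slice_bergman_space \<Omega> j. f q = slice_inner \<Omega> j K f))"

definition slice_bergman_kernel :: "quat set \<Rightarrow> quat \<Rightarrow> quat \<Rightarrow> quat \<Rightarrow> quat" where
  "slice_bergman_kernel \<Omega> j q r = qcnj (slice_bergman_rep \<Omega> j q r)"

text \<open>
  The units \<open>i\<close>, \<open>j\<close> and the coordinates \<open>x\<close>, \<open>y\<close> are not determined by \<open>q\<close> and
  \<open>r\<close>: there are two choices, and a whole sphere of choices at real points. The
  kernel is the common value over all admissible choices.
\<close>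

definition slice_bergman_kernel2 :: "quat set \<Rightarrow> quat \<Rightarrow> quat \<Rightarrow> quat" where
  "slice_bergman_kernel2 \<Omega> q r =
     (THE k. \<forall>i\<in>imag_unit_sphere. \<forall>j\<in>imag_unit_sphere. \<forall>x y.
        q = slice_point i x y \<longrightarrow> r \<in> \<Omega> \<inter> slice_plane j \<longrightarrow>
        k = (1 / 2) *\<^sub>R ((1 - i * j) * slice_bergman_kernel \<Omega> j (slice_point j x y) r)
          + (1 / 2) *\<^sub>R ((1 + i * j) * slice_bergman_kernel \<Omega> j (slice_point j x (- y)) r))"

definition right_half_space :: "quat set" where
  "right_half_space = {q. 0 < qRe q}"

end

theory Submission
  imports Defs "HOL-Complex_Analysis.Complex_Analysis" "HOL-Probability.Sinc_Integral"
    "HOL-Real_Asymp.Real_Asymp"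
begin

text \<open>
  The complex heart of the matter is the reproducing formula
  \<open>\<pi> F(q) = \<integral> F(w) (q + cnj w)\<^sup>-\<^sup>2 dA(w)\<close> for square integrable holomorphic \<open>F\<close> on the
  right half plane. On the line \<open>Re w = x\<close> one has \<open>q + cnj w = (q + 2x) - w\<close>, so Cauchy's
  formula turns the integral over this line into \<open>-2\<pi> F'(q + 2x)\<close>, and integrating over \<open>x > 0\<close>
  leaves \<open>\<pi> F(q)\<close> because \<open>F\<close> decays like \<open>1 / Re w\<close>. The decay follows by averaging Cauchy's
  formula for \<open>F\<^sup>2\<close> over the boundaries of concentric squares.

  A slice regular \<open>f\<close> restricted to \<open>\<complex>(j)\<close> is holomorphic after multiplying by a constant on the
  right and projecting orthogonally to \<open>\<complex>(j)\<close>, and these projections determine \<open>f\<close>.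
  Hence the kernel on a slice is the complex one, and it only remains to extend it to the other slices.
\<close>

section \<open>The Bergman kernel of the complex right half plane\<close>

text \<open>Two definite descriptions shape the argument. The representing function in
  \<open>slice_bergman_rep\<close> has to be unique among functions on the whole half space,
  although the inner product sees a single slice; hence the identity theorem and the care for
  \<open>extensional\<close>. And the value in \<open>slice_bergman_kernel2\<close> has to be the
  same for all units and coordinates that describe \<open>q\<close> and \<open>r\<close>; this
  follows once the extended kernel is written in terms of \<open>q\<close> and \<open>r\<close>
  alone. The obstacle to the latter is that \<open>1 / (pi * (z + cnj w)^2)\<close> mixes two
  variables which end up on different slices and no longer commute. Enlarging the fraction by the
  square of \<open>cnj z + cnj w\<close> or of \<open>z + w\<close> makes the denominator a
  polynomial in one variable whose real coefficients come from the other. The kernel is then a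
  finite sum of products u(z) v(w), and the extension turns each into
  \<open>slice_emb i u * slice_emb j v\<close>. The two enlargements are the origin of the two
  closed forms.\<close>

lemma contour_integral_rectpath:
  assumes "continuous_on (path_image (rectpath a b)) f"
  shows "contour_integral (rectpath a b) f =
     contour_integral (linepath a (Complex (Re b) (Im a))) f
   + contour_integral (linepath (Complex (Re b) (Im a)) b) f
   + contour_integral (linepath b (Complex (Re a) (Im b))) f
   + contour_integral (linepath (Complex (Re a) (Im b)) a) f"
proof -
  have "f contour_integrable_on linepath a (Complex (Re b) (Im a))"
    "f contour_integrable_on linepath (Complex (Re b) (Im a)) b"
    "f contour_integrable_on linepath b (Complex (Re a) (Im b))"
    "f contour_integrable_on linepath (Complex (Re a) (Im b)) a"
    by (intro contour_integrable_continuous_linepath continuous_on_subset[OF assms];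
        auto simp: rectpath_def Let_def path_image_join)+
  then show ?thesis
    by (simp add: rectpath_def Let_def contour_integrable_join)
qed

text \<open>The nonnegative majorant is integrated over the whole line, not just over the segment:
  the bound then does not depend on the end points, and Tonelli can recombine the lines later.
  \<open>c\<close> may be negative because two sides of a rectangle are traversed backwards.\<close>

lemma contour_integral_linepath_le_nn_integral:
  fixes f :: "complex \<Rightarrow> complex" and h :: "real \<Rightarrow> ennreal"
  assumes f: "continuous_on (closed_segment a b) f"
    and [measurable]: "h \<in> borel_measurable borel"
    and c: "\<bar>c\<bar> = norm (b - a)" "c \<noteq> 0"
    and le: "\<And>t. 0 \<le> t \<Longrightarrow> t \<le> 1 \<Longrightarrow> ennreal (norm (f (linepath a b t))) \<le> h (d + c * t)"
  shows "ennreal (norm (contour_integral (linepath a b) f)) \<le> (\<integral>\<^sup>+t. h t \<partial>lborel)"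
proof -
  let ?g = "\<lambda>t. f (linepath a b t)"
  have "continuous_on {0..1} ?g"
    by (rule continuous_on_compose2[OF f])
      (auto simp: linepath_in_path intro: continuous_intros)
  then have int: "set_integrable lborel {0..1} ?g"
    by (rule borel_integrable_atLeastAtMost')
  have "norm (contour_integral (linepath a b) f) = \<bar>c\<bar> * norm (LINT t:{0..1}|lborel. ?g t)"
    by (simp add: contour_integral_integral set_borel_integral_eq_integral(2)[OF int] c norm_mult)
  also have "ennreal \<dots> = \<bar>c\<bar> * ennreal (norm (LINT t:{0..1}|lborel. ?g t))"
    by (simp add: ennreal_mult)
  also have "\<dots> \<le> \<bar>c\<bar> * (\<integral>\<^sup>+t. ennreal (norm (indicator {0..1} t *\<^sub>R ?g t)) \<partial>lborel)"
    unfolding set_lebesgue_integral_def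
    by (intro mult_left_mono integral_norm_bound_ennreal) (use int in \<open>auto simp: set_integrable_def\<close>)
  also have "\<dots> \<le> \<bar>c\<bar> * (\<integral>\<^sup>+t. h (d + c * t) \<partial>lborel)"
    by (intro mult_left_mono nn_integral_mono) (auto simp: indicator_def intro!: le)
  also have "\<dots> = (\<integral>\<^sup>+t. h t \<partial>lborel)"
    using c by (subst nn_integral_real_affine[of h c d]) auto
  finally show ?thesis .
qed

text \<open>Cauchy's formula at the centre of a square. Every boundary point has distance at least
  \<open>s\<close> from the centre, so the Cauchy kernel multiplied by \<open>s\<close> has modulus
  at most 1, which leaves the integrals of |F| over the four sides. The majorant \<open>G\<close> is
  separate from \<open>F\<close> because it has to live on complete lines, also outside
  \<open>S\<close>.\<close>

lemma holomorphic_square_estimate: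
  fixes F :: "complex \<Rightarrow> complex"
  assumes F: "F holomorphic_on S" and sub: "cbox (Complex (a - s) (b - s)) (Complex (a + s) (b + s)) \<subseteq> S"
    and s: "0 < s"
    and [measurable]: "(\<lambda>y. G (a + s) y) \<in> borel_measurable borel" "(\<lambda>y. G (a - s) y) \<in> borel_measurable borel"
      "(\<lambda>x. G x (b + s)) \<in> borel_measurable borel" "(\<lambda>x. G x (b - s)) \<in> borel_measurable borel"
    and G: "\<And>x y. Complex x y \<in> S \<Longrightarrow> ennreal (norm (F (Complex x y))) \<le> G x y"
  shows "ennreal (2 * pi * s * norm (F (Complex a b)))
    \<le> (\<integral>\<^sup>+y. G (a + s) y \<partial>lborel) + (\<integral>\<^sup>+y. G (a - s) y \<partial>lborel)
      + (\<integral>\<^sup>+x. G x (b + s) \<partial>lborel) + (\<integral>\<^sup>+x. G x (b - s) \<partial>lborel)"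
proof -
  define w where "w = Complex a b"
  define a1 where "a1 = Complex (a - s) (b - s)"
  define a3 where "a3 = Complex (a + s) (b + s)"
  let ?Q = "rectpath a1 a3"
  let ?h = "\<lambda>z. of_real s * (F z / (z - w))"
  have le: "Re a1 \<le> Re a3" "Im a1 \<le> Im a3" and wbox: "w \<in> box a1 a3"
    using s by (auto simp: a1_def a3_def w_def in_box_complex_iff)
  have holQ: "F holomorphic_on cbox a1 a3"
    using F sub unfolding a1_def a3_def by (rule holomorphic_on_subset)
  have img: "path_image ?Q = cbox a1 a3 - box a1 a3"
    using le by (rule path_image_rectpath_cbox_minus_box)
  have "((\<lambda>z. F z / (z - w)) has_contour_integral (2 * pi * \<i> * winding_number ?Q w * F w)) ?Q"
    by (rule Cauchy_integral_formula_convex_simple[OF _ holQ])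
      (use wbox img in \<open>auto simp: interior_cbox\<close>)
  then have "(?h has_contour_integral (of_real s * (2 * pi * \<i> * F w))) ?Q"
    using wbox by (intro has_contour_integral_lmul) (simp add: winding_number_rectpath)
  then have ci: "contour_integral ?Q ?h = of_real s * (2 * pi * \<i> * F w)"
    by (rule contour_integral_unique)
  have cont: "continuous_on (path_image ?Q) ?h"
    using wbox unfolding img
    by (intro continuous_intros continuous_on_subset[OF holomorphic_on_imp_continuous_on[OF holQ]]) auto
  have bound: "ennreal (norm (?h (Complex x y))) \<le> G x y"
    if "Complex x y \<in> path_image ?Q" for x y
  proof -
    have "s \<le> max \<bar>x - a\<bar> \<bar>y - b\<bar>"
      using that s unfolding path_image_rectpath[OF le] by (auto simp: a1_def a3_def)
    also have "\<dots> \<le> norm (Complex x y - w)"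
      using abs_Re_le_cmod[of "Complex x y - w"] abs_Im_le_cmod[of "Complex x y - w"]
      by (auto simp: w_def)
    finally have d: "s \<le> norm (Complex x y - w)" .
    then have "s * norm (F (Complex x y)) / norm (Complex x y - w) \<le> norm (F (Complex x y))"
      using s mult_right_mono[OF d norm_ge_zero[of "F (Complex x y)"]]
      by (subst pos_divide_le_eq) (linarith, simp add: mult.commute)
    moreover have "Complex x y \<in> S"
      using that sub img by (auto simp: a1_def a3_def)
    ultimately show ?thesis
      using G[of x y] s by (simp add: norm_mult norm_divide) (meson ennreal_leI order_trans)
  qed
  have seg: "closed_segment a1 (Complex (Re a3) (Im a1)) \<subseteq> path_image ?Q"
    "closed_segment (Complex (Re a3) (Im a1)) a3 \<subseteq> path_image ?Q"
    "closed_segment a3 (Complex (Re a1) (Im a3)) \<subseteq> path_image ?Q"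
    "closed_segment (Complex (Re a1) (Im a3)) a1 \<subseteq> path_image ?Q"
    by (auto simp: rectpath_def Let_def path_image_join)
  have pt: "\<And>t. linepath a1 (Complex (Re a3) (Im a1)) t = Complex (a - s + 2 * s * t) (b - s)"
    "\<And>t. linepath (Complex (Re a3) (Im a1)) a3 t = Complex (a + s) (b - s + 2 * s * t)"
    "\<And>t. linepath a3 (Complex (Re a1) (Im a3)) t = Complex (a + s + - 2 * s * t) (b + s)"
    "\<And>t. linepath (Complex (Re a1) (Im a3)) a1 t = Complex (a - s) (b + s + - 2 * s * t)"
    by (auto simp: linepath_def a1_def a3_def complex_eq_iff algebra_simps)
  have mem: "linepath u v t \<in> path_image ?Q"
    if "closed_segment u v \<subseteq> path_image ?Q" "0 \<le> t" "t \<le> 1" for u v t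
    using that linepath_in_path[of t u v] by auto
  have "Complex (Re a3) (Im a1) - a1 = of_real (2 * s)" "a3 - Complex (Re a3) (Im a1) = \<i> * of_real (2 * s)"
    "Complex (Re a1) (Im a3) - a3 = of_real (- 2 * s)" "a1 - Complex (Re a1) (Im a3) = \<i> * of_real (- 2 * s)"
    by (auto simp: a1_def a3_def complex_eq_iff)
  then have len: "\<bar>2 * s\<bar> = norm (Complex (Re a3) (Im a1) - a1)" "\<bar>2 * s\<bar> = norm (a3 - Complex (Re a3) (Im a1))"
    "\<bar>- 2 * s\<bar> = norm (Complex (Re a1) (Im a3) - a3)" "\<bar>- 2 * s\<bar> = norm (a1 - Complex (Re a1) (Im a3))"
    by (simp_all only: norm_mult norm_of_real norm_ii mult_1)
  have ne: "2 * s \<noteq> 0" "- 2 * s \<noteq> 0" using s by auto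
  have n1: "ennreal (norm (contour_integral (linepath a1 (Complex (Re a3) (Im a1))) ?h)) \<le> (\<integral>\<^sup>+t. (\<lambda>x. G x (b - s)) t \<partial>lborel)"
    by (rule contour_integral_linepath_le_nn_integral[OF continuous_on_subset[OF cont seg(1)] _ len(1) ne(1)])
      (use mem[OF seg(1)] in \<open>auto simp only: pt(1) intro!: bound\<close>, measurable)
  have n2: "ennreal (norm (contour_integral (linepath (Complex (Re a3) (Im a1)) a3) ?h)) \<le> (\<integral>\<^sup>+t. (\<lambda>y. G (a + s) y) t \<partial>lborel)"
    by (rule contour_integral_linepath_le_nn_integral[OF continuous_on_subset[OF cont seg(2)] _ len(2) ne(1)])
      (use mem[OF seg(2)] in \<open>auto simp only: pt(2) intro!: bound\<close>, measurable)
  have n3: "ennreal (norm (contour_integral (linepath a3 (Complex (Re a1) (Im a3))) ?h)) \<le> (\<integral>\<^sup>+t. (\<lambda>x. G x (b + s)) t \<partial>lborel)"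
    by (rule contour_integral_linepath_le_nn_integral[OF continuous_on_subset[OF cont seg(3)] _ len(3) ne(2)])
      (use mem[OF seg(3)] in \<open>auto simp only: pt(3) intro!: bound\<close>, measurable)
  have n4: "ennreal (norm (contour_integral (linepath (Complex (Re a1) (Im a3)) a1) ?h)) \<le> (\<integral>\<^sup>+t. (\<lambda>y. G (a - s) y) t \<partial>lborel)"
    by (rule contour_integral_linepath_le_nn_integral[OF continuous_on_subset[OF cont seg(4)] _ len(4) ne(2)])
      (use mem[OF seg(4)] in \<open>auto simp only: pt(4) intro!: bound\<close>, measurable)
  have "2 * pi * s * norm (F w) = norm (contour_integral ?Q ?h)"
    unfolding ci using s by (simp add: norm_mult)
  also have "\<dots> \<le> norm (contour_integral (linepath a1 (Complex (Re a3) (Im a1))) ?h)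
     + norm (contour_integral (linepath (Complex (Re a3) (Im a1)) a3) ?h)
     + norm (contour_integral (linepath a3 (Complex (Re a1) (Im a3))) ?h)
     + norm (contour_integral (linepath (Complex (Re a1) (Im a3)) a1) ?h)"
    unfolding contour_integral_rectpath[OF cont]
    by (intro order_trans[OF norm_triangle_ineq] add_mono order_refl)
  finally have "ennreal (2 * pi * s * norm (F w)) \<le> ennreal \<dots>"
    by (rule ennreal_leI)
  also have "\<dots> \<le> (\<integral>\<^sup>+x. G x (b - s) \<partial>lborel) + (\<integral>\<^sup>+y. G (a + s) y \<partial>lborel)
      + (\<integral>\<^sup>+x. G x (b + s) \<partial>lborel) + (\<integral>\<^sup>+y. G (a - s) y \<partial>lborel)"
    by (simp only: ennreal_plus add_nonneg_nonneg norm_ge_zero) (intro add_mono n1 n2 n3 n4)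
  finally show ?thesis
    by (simp add: w_def ac_simps)
qed

section \<open>Pointwise bounds from square integrability\<close>

lemma measurable_half_plane:
  fixes f :: "complex \<Rightarrow> 'b :: real_normed_vector"
  assumes "continuous_on {z. 0 < Re z} f"
  shows "(\<lambda>p. indicator {0<..} (fst p) *\<^sub>R f (Complex (fst p) (snd p))) \<in> borel_measurable borel"
proof -
  have c: "continuous_on UNIV (\<lambda>p::real\<times>real. Complex (fst p) (snd p))"
    unfolding Complex_eq by (intro continuous_intros)
  have "open {p::real\<times>real. 0 < fst p}"
    by (intro open_Collect_less continuous_intros)
  then have "(\<lambda>p::real\<times>real. indicator {p. 0 < fst p} p *\<^sub>R f (Complex (fst p) (snd p))) \<in> borel_measurable borel"
    by (intro borel_measurable_continuous_on_indicator continuous_on_compose2[OF assms]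
        continuous_on_subset[OF c]) auto
  then show ?thesis
    by (simp add: indicator_def)
qed

text \<open>\<open>holomorphic_square_estimate\<close> is applied to F^2, whose modulus is the
  density of the integral, and is then integrated over the half side s from 0 to \<open>R\<close>;
  the factor 2 pi s becomes pi R^2. Squares serve better than discs here: their sides lie on
  coordinate lines, so by Tonelli each of the four sides sweeps out at most the full integral. Hence
  the factor 4.\<close>

lemma bergman_point_estimate:
  fixes F :: "complex \<Rightarrow> complex"
  assumes F: "F holomorphic_on {z. 0 < Re z}" and R: "0 < R" "R < Re w"
  shows "ennreal (pi * R\<^sup>2 * (norm (F w))\<^sup>2) \<le>
    4 * (\<integral>\<^sup>+p. ennreal (indicator {0<..} (fst p) * (norm (F (Complex (fst p) (snd p))))\<^sup>2) \<partial>(lborel :: (real \<times> real) measure))"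
    (is "_ \<le> 4 * ?M")
proof -
  define G where "G x y = ennreal (indicator {0<..} x * (norm (F (Complex x y)))\<^sup>2)" for x y
  define a b where "a = Re w" and "b = Im w"
  have ab: "w = Complex a b" by (simp add: a_def b_def)
  have G: "G x y = ennreal ((norm (indicator {0<..} x *\<^sub>R F (Complex x y)))\<^sup>2)" for x y
    by (auto simp: G_def indicator_def)
  have meas: "(\<lambda>p. G (fst p) (snd p)) \<in> borel_measurable borel"
    using measurable_half_plane[OF holomorphic_on_imp_continuous_on[OF F]]
    unfolding G by measurable
  then have meas' [measurable]: "(\<lambda>p. G (fst p) (snd p)) \<in> borel_measurable (borel \<Otimes>\<^sub>M borel)"
    by (simp add: borel_prod)
  have [measurable]: "(\<lambda>x. G (f x) (g x)) \<in> borel_measurable N"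
    if [measurable]: "f \<in> borel_measurable N" "g \<in> borel_measurable N"
    for f g and N :: "'z measure"
    using measurable_compose[OF measurable_Pair[OF that] meas'] by simp
  have M1: "?M = (\<integral>\<^sup>+x. \<integral>\<^sup>+y. G x y \<partial>lborel \<partial>lborel)"
    using meas lborel.nn_integral_fst[of "\<lambda>p. G (fst p) (snd p)" lborel]
    by (simp add: lborel_prod G_def)
  have M2: "?M = (\<integral>\<^sup>+y. \<integral>\<^sup>+x. G x y \<partial>lborel \<partial>lborel)"
    using meas lborel_pair.nn_integral_snd[of "\<lambda>p. G (fst p) (snd p)"]
    by (simp add: lborel_prod G_def case_prod_unfold)
  define H1 where "H1 x = (\<integral>\<^sup>+y. G x y \<partial>lborel)" for x
  define H2 where "H2 y = (\<integral>\<^sup>+x. G x y \<partial>lborel)" for y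
  have [measurable]: "H1 \<in> borel_measurable borel" "H2 \<in> borel_measurable borel"
    unfolding H1_def H2_def by measurable
  have sq: "ennreal (2 * pi * s * (norm (F w))\<^sup>2) \<le> H1 (a + s) + H1 (a - s) + H2 (b + s) + H2 (b - s)"
    if s: "0 < s" "s \<le> R" for s
  proof -
    have "(\<lambda>z. (F z)\<^sup>2) holomorphic_on {z. 0 < Re z}"
      by (intro holomorphic_intros F)
    then have "ennreal (2 * pi * s * norm ((F (Complex a b))\<^sup>2)) \<le> H1 (a + s) + H1 (a - s) + H2 (b + s) + H2 (b - s)"
      unfolding H1_def H2_def
    proof (rule holomorphic_square_estimate)
      show "ennreal (norm ((F (Complex x y))\<^sup>2)) \<le> G x y" if "Complex x y \<in> {z. 0 < Re z}" for x y
        using that by (simp add: G_def norm_power)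
    qed (use s R in \<open>auto simp: in_cbox_complex_iff a_def\<close>)
    then show ?thesis
      by (simp add: ab norm_power)
  qed
  have shift: "(\<integral>\<^sup>+s. H (d + s) \<partial>lborel) = (\<integral>\<^sup>+s. H s \<partial>lborel)" "(\<integral>\<^sup>+s. H (d - s) \<partial>lborel) = (\<integral>\<^sup>+s. H s \<partial>lborel)"
    if [measurable]: "H \<in> borel_measurable borel" for H :: "real \<Rightarrow> ennreal" and d
    using nn_integral_real_affine[of H 1 d] nn_integral_real_affine[of H "-1" d] by simp_all
  have "((\<lambda>s. pi * s\<^sup>2 * (norm (F w))\<^sup>2) has_real_derivative 2 * pi * s * (norm (F w))\<^sup>2) (at s)" for s
    by (auto intro!: derivative_eq_intros)
  then have "(\<integral>\<^sup>+s. ennreal (2 * pi * s * (norm (F w))\<^sup>2) * indicator {0..R} s \<partial>lborel)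
      = ennreal (pi * R\<^sup>2 * (norm (F w))\<^sup>2 - pi * 0\<^sup>2 * (norm (F w))\<^sup>2)"
    using R by (intro nn_integral_FTC_Icc[where F = "\<lambda>s. pi * s\<^sup>2 * (norm (F w))\<^sup>2"]) auto
  then have "ennreal (pi * R\<^sup>2 * (norm (F w))\<^sup>2) = 
     (\<integral>\<^sup>+s. ennreal (2 * pi * s * (norm (F w))\<^sup>2) * indicator {0..R} s \<partial>lborel)"
    by simp
  also have "\<dots> \<le> (\<integral>\<^sup>+s. H1 (a + s) + H1 (a - s) + H2 (b + s) + H2 (b - s) \<partial>lborel)"
  proof (rule nn_integral_mono)
    fix s :: real
    show "ennreal (2 * pi * s * (norm (F w))\<^sup>2) * indicator {0..R} s
      \<le> H1 (a + s) + H1 (a - s) + H2 (b + s) + H2 (b - s)"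
      using sq[of s] by (cases "s = 0") (auto simp: indicator_def)
  qed
  also have "\<dots> = ?M + ?M + ?M + ?M"
    by (subst nn_integral_add; (subst nn_integral_add)?; (subst nn_integral_add)?)
      (simp_all add: shift M1[folded H1_def, symmetric] M2[folded H2_def, symmetric])
  also have "\<dots> = 4 * ?M"
  proof -
    have "4 * ?M = (1 + 1 + 1 + 1) * ?M" by simp
    then show ?thesis by (simp only: distrib_right mult_1)
  qed
  finally show ?thesis .
qed

section \<open>Integrals over vertical lines\<close>

lemma integrable_inverse_add_square:
  fixes a b :: real
  assumes "0 < a"
  shows "integrable lborel (\<lambda>y. 1 / (a\<^sup>2 + (y - b)\<^sup>2))"
proof -
  have "integrable lborel (\<lambda>x::real. inverse (1 + x\<^sup>2))"
    using integrable_inverse_1_plus_square by (simp add: set_integrable_def)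
  then have "integrable lborel (\<lambda>y. inverse (1 + (- b / a + (1 / a) * y)\<^sup>2) / a\<^sup>2)"
    using assms by (intro integrable_divide_zero lborel_integrable_real_affine[of "\<lambda>x. inverse (1 + x\<^sup>2)"]) auto
  moreover have "inverse (1 + (- b / a + (1 / a) * y)\<^sup>2) / a\<^sup>2 = 1 / (a\<^sup>2 + (y - b)\<^sup>2)" for y
  proof -
    have "1 + (- b / a + (1 / a) * y)\<^sup>2 = (a\<^sup>2 + (y - b)\<^sup>2) / a\<^sup>2"
      using assms by (simp add: field_simps power2_eq_square)
    then show ?thesis using assms by simp
  qed
  ultimately show ?thesis by simp
qed

text \<open>Since (F / (z - p))' = F' / (z - p) - F / (z - p)^2, the double pole differs from a
  simple pole with numerator F' by a function with a primitive off \<open>p\<close>, whose integral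
  over the closed path vanishes.\<close>

lemma contour_integral_rectpath_double_pole:
  assumes F: "F holomorphic_on S" and S: "open S" "convex S" "cbox a b \<subseteq> S" and p: "p \<in> box a b"
  shows "contour_integral (rectpath a b) (\<lambda>z. F z / (z - p)\<^sup>2) = 2 * pi * \<i> * deriv F p"
proof -
  let ?Q = "rectpath a b"
  have le: "Re a \<le> Re b" "Im a \<le> Im b"
    using p by (auto simp: in_box_complex_iff)
  have img: "path_image ?Q \<subseteq> S - {p}"
    using S(3) p unfolding path_image_rectpath_cbox_minus_box[OF le] by auto
  have pS: "p \<in> S"
    using p S(3) box_subset_cbox[of a b] by auto
  have F': "deriv F holomorphic_on S"
    using F S(1) by (rule holomorphic_deriv)
  have "((\<lambda>z. deriv F z / (z - p)) has_contour_integral (2 * pi * \<i> * winding_number ?Q p * deriv F p)) ?Q"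
    by (rule Cauchy_integral_formula_convex_simple[OF S(2) F'])
      (use pS img S(1) in \<open>auto simp: interior_open\<close>)
  then have 1: "((\<lambda>z. deriv F z / (z - p)) has_contour_integral (2 * pi * \<i> * deriv F p)) ?Q"
    using p by (simp add: winding_number_rectpath)
  have 2: "((\<lambda>z. deriv F z / (z - p) - F z / (z - p)\<^sup>2) has_contour_integral 0) ?Q"
  proof (rule Cauchy_theorem_primitive)
    fix z assume z: "z \<in> S - {p}"
    then have "(F has_field_derivative deriv F z) (at z within S - {p})"
      using F S(1) holomorphic_derivI by (blast intro: has_field_derivative_at_within)
    moreover have "((\<lambda>z. z - p) has_field_derivative 1) (at z within S - {p})"
      by (auto intro!: derivative_eq_intros)
    ultimately show "((\<lambda>z. F z / (z - p)) has_field_derivative (deriv F z / (z - p) - F z / (z - p)\<^sup>2)) (at z within S - {p})"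
      using z by (intro DERIV_cong[OF DERIV_divide]) (auto simp: diff_divide_distrib power2_eq_square)
  qed (use img in auto)
  show ?thesis
    using contour_integral_unique[OF has_contour_integral_diff[OF 1 2]] by simp
qed

text \<open>The line is the limit of the left sides of growing rectangles around \<open>p\<close>;
  the other three sides vanish in the limit because F is bounded and the kernel decays
  quadratically. The left side is traversed downwards, which gives the minus sign, and dz = i dy
  cancels the i of Cauchy's formula.\<close>

lemma vertical_line_integral_double_pole:
  fixes F :: "complex \<Rightarrow> complex"
  assumes F: "F holomorphic_on {z. 0 < Re z}" and x: "0 < x" "x < Re p"
    and C: "\<And>z. x \<le> Re z \<Longrightarrow> norm (F z) \<le> C"
  shows "integrable lborel (\<lambda>y. F (Complex x y) / (Complex x y - p)\<^sup>2)"
    and "(LINT y|lborel. F (Complex x y) / (Complex x y - p)\<^sup>2) = - (2 * pi * deriv F p)"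
proof -
  let ?f = "\<lambda>z. F z / (z - p)\<^sup>2"
  let ?g = "\<lambda>y. ?f (Complex x y)"
  have C0: "0 \<le> C"
    using order_trans[OF norm_ge_zero C[of "of_real x"]] by simp
  have contf: "continuous_on ({z. 0 < Re z} - {p}) ?f"
    by (intro continuous_intros continuous_on_subset[OF holomorphic_on_imp_continuous_on[OF F]]) auto
  have contc: "continuous_on UNIV (\<lambda>y. Complex x y)"
    unfolding Complex_eq by (intro continuous_intros)
  have contg: "continuous_on UNIV ?g"
    by (rule continuous_on_compose2[OF contf contc]) (use x in auto)
  have "integrable lborel (\<lambda>y. C * (1 / ((Re p - x)\<^sup>2 + (y - Im p)\<^sup>2)))"
    using x by (intro integrable_mult_right integrable_inverse_add_square) auto
  then show int: "integrable lborel ?g"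
  proof (rule Bochner_Integration.integrable_bound)
    show "?g \<in> borel_measurable lborel"
      using contg by (simp add: borel_measurable_continuous_onI)
    show "AE y in lborel. norm (?g y) \<le> norm (C * (1 / ((Re p - x)\<^sup>2 + (y - Im p)\<^sup>2)))"
    proof (rule AE_I2)
      fix y
      have "norm (Complex x y - p) ^ 2 = (Re p - x)\<^sup>2 + (y - Im p)\<^sup>2"
        by (simp add: cmod_power2 power2_commute)
      then show "norm (?g y) \<le> norm (C * (1 / ((Re p - x)\<^sup>2 + (y - Im p)\<^sup>2)))"
        using C[of "Complex x y"] C0 by (auto simp: norm_divide norm_power intro!: divide_right_mono)
    qed
  qed
  define I where "I n = (LINT y|lborel. indicator {- real n..real n} y *\<^sub>R ?g y)" for n :: nat
  have lim1: "I \<longlonglongrightarrow> (LINT y|lborel. ?g y)"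
    unfolding I_def
  proof (rule integral_dominated_convergence[where w = "\<lambda>y. norm (?g y)"])
    show "AE y in lborel. (\<lambda>n. indicator {- real n..real n} y *\<^sub>R ?g y) \<longlonglongrightarrow> ?g y"
    proof (rule AE_I2)
      fix y
      obtain N where "\<bar>y\<bar> \<le> real N" using real_arch_simple by blast
      then have "\<forall>n\<ge>N. indicator {- real n..real n} y *\<^sub>R ?g y = ?g y"
        by (auto simp: indicator_def)
      then show "(\<lambda>n. indicator {- real n..real n} y *\<^sub>R ?g y) \<longlonglongrightarrow> ?g y"
        by (intro tendsto_eventually) (auto simp: eventually_sequentially)
    qed
  qed (use int in \<open>auto simp: indicator_def\<close>)
  \<comment> \<open>The rectangle has the corners x - i n and x + n + i n. On its bottom, right and
    top sides the real or the imaginary part has modulus at least n, so |z - p| is at least n - |p|;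
    their total length is n + 2 n + n = 4 n.\<close>
  have ev: "norm (I n - - (2 * pi * deriv F p)) \<le> C / (real n - norm p)\<^sup>2 * (4 * real n)"
    if n: "norm p < real n" for n
  proof -
    define a where "a = Complex x (- real n)"
    define b where "b = Complex (x + real n) (real n)"
    let ?a' = "Complex (Re b) (Im a)" and ?b' = "Complex (Re a) (Im b)"
    have n0: "0 < real n" using n norm_ge_zero[of p] by linarith
    have p: "p \<in> box a b"
      using n x abs_Re_le_cmod[of p] abs_Im_le_cmod[of p] by (auto simp: a_def b_def in_box_complex_iff)
    have box: "cbox a b \<subseteq> {z. 0 < Re z}"
      using x by (auto simp: a_def b_def in_cbox_complex_iff)
    have le: "Re a \<le> Re b" "Im a \<le> Im b"
      using n0 by (auto simp: a_def b_def)
    have "convex {z. 0 < Re z}" "open {z. 0 < Re z}"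
      by (simp_all add: convex_halfspace_Re_gt open_halfspace_Re_gt)
    then have ci: "contour_integral (rectpath a b) ?f = 2 * pi * \<i> * deriv F p"
      using F box p by (intro contour_integral_rectpath_double_pole)
    have cont: "continuous_on (path_image (rectpath a b)) ?f"
      by (rule continuous_on_subset[OF contf])
        (use box p path_image_rectpath_cbox_minus_box[OF le] in auto)
    have seg: "closed_segment a ?a' \<subseteq> path_image (rectpath a b)"
      "closed_segment ?a' b \<subseteq> path_image (rectpath a b)"
      "closed_segment b ?b' \<subseteq> path_image (rectpath a b)"
      "closed_segment ?b' a \<subseteq> path_image (rectpath a b)"
      by (auto simp: rectpath_def Let_def path_image_join)
    have fb: "norm (?f z) \<le> C / (real n - norm p)\<^sup>2" if "x \<le> Re z" "real n \<le> norm z" for z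
    proof -
      have "real n - norm p \<le> norm (z - p)"
        using that norm_triangle_ineq2[of z p] by linarith
      then have "(real n - norm p)\<^sup>2 \<le> (norm (z - p))\<^sup>2"
        using n by (intro power_mono) auto
      then show ?thesis
        using C[of z] C0 n that unfolding norm_divide norm_power
        by (intro frac_le) auto
    qed
    have side: "norm (contour_integral (linepath u v) ?f) \<le> C / (real n - norm p)\<^sup>2 * norm (v - u)"
      if "closed_segment u v \<subseteq> path_image (rectpath a b)"
        "\<And>z. z \<in> closed_segment u v \<Longrightarrow> x \<le> Re z \<and> real n \<le> norm z" for u v
      using that C0 by (intro contour_integral_bound_linepath contour_integrable_continuous_linepath
          continuous_on_subset[OF cont]) (auto intro!: fb)
    have absn: "real n \<le> norm z" if "real n \<le> \<bar>Re z\<bar> \<or> real n \<le> \<bar>Im z\<bar>" for z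
      using that abs_Re_le_cmod[of z] abs_Im_le_cmod[of z] by linarith
    have s1: "norm (contour_integral (linepath a ?a') ?f) \<le> C / (real n - norm p)\<^sup>2 * norm (?a' - a)"
      using n0 by (intro side seg(1)) (auto simp: a_def b_def closed_segment_same_Im closed_segment_eq_real_ivl intro!: absn)
    have s2: "norm (contour_integral (linepath ?a' b) ?f) \<le> C / (real n - norm p)\<^sup>2 * norm (b - ?a')"
      using n0 x by (intro side seg(2)) (auto simp: a_def b_def closed_segment_same_Re closed_segment_eq_real_ivl intro!: absn)
    have s3: "norm (contour_integral (linepath b ?b') ?f) \<le> C / (real n - norm p)\<^sup>2 * norm (?b' - b)"
      using n0 by (intro side seg(3)) (auto simp: a_def b_def closed_segment_same_Im closed_segment_eq_real_ivl intro!: absn)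
    have "?a' - a = of_real n" "b - ?a' = \<i> * of_real (2 * n)" "?b' - b = of_real (- n)"
      by (auto simp: a_def b_def complex_eq_iff)
    then have len: "norm (?a' - a) = n" "norm (b - ?a') = 2 * n" "norm (?b' - b) = n"
      by (simp_all only: norm_mult norm_of_real norm_ii mult_1)
    have "contour_integral (linepath ?b' a) ?f = - contour_integral (linepath a ?b') ?f"
      using continuous_on_subset[OF cont seg(4)]
      by (subst contour_integral_reverse_linepath) auto
    also have "contour_integral (linepath a ?b') ?f = \<i> * integral {- real n..real n} ?g"
      by (rule contour_integral_linepath_same_Re) (use n0 in \<open>auto simp: a_def b_def\<close>)
    also have "integral {- real n..real n} ?g = I n"
    proof -
      have "set_integrable lborel {- real n..real n} ?g"
        by (rule borel_integrable_atLeastAtMost'[OF continuous_on_subset[OF contg]]) simp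
      then show ?thesis
        by (simp add: I_def set_borel_integral_eq_integral(2)[symmetric] set_lebesgue_integral_def)
    qed
    finally have s4: "contour_integral (linepath ?b' a) ?f = - (\<i> * I n)" .
    have "2 * pi * \<i> * deriv F p = contour_integral (linepath a ?a') ?f
        + contour_integral (linepath ?a' b) ?f + contour_integral (linepath b ?b') ?f - \<i> * I n"
      using ci unfolding contour_integral_rectpath[OF cont] s4 by simp
    then have "\<i> * (I n - - (2 * pi * deriv F p)) = contour_integral (linepath a ?a') ?f
        + contour_integral (linepath ?a' b) ?f + contour_integral (linepath b ?b') ?f"
      by (simp add: algebra_simps)
    then have "norm (I n - - (2 * pi * deriv F p)) = norm (contour_integral (linepath a ?a') ?f
        + contour_integral (linepath ?a' b) ?f + contour_integral (linepath b ?b') ?f)"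
      by (metis norm_mult norm_ii mult_1)
    also have "\<dots> \<le> norm (contour_integral (linepath a ?a') ?f)
        + norm (contour_integral (linepath ?a' b) ?f) + norm (contour_integral (linepath b ?b') ?f)"
      by (intro order_trans[OF norm_triangle_ineq] add_mono order_refl)
    also have "\<dots> \<le> C / (real n - norm p)\<^sup>2 * real n + C / (real n - norm p)\<^sup>2 * (2 * real n) + C / (real n - norm p)\<^sup>2 * real n"
      using s1 s2 s3 unfolding len by simp
    finally show ?thesis
      by (simp add: algebra_simps)
  qed
  have "(\<lambda>n. C / (real n - norm p)\<^sup>2 * (4 * real n)) \<longlonglongrightarrow> 0"
    by real_asymp
  moreover have "\<forall>\<^sub>F n in sequentially. norm (I n - - (2 * pi * deriv F p)) \<le> C / (real n - norm p)\<^sup>2 * (4 * real n)"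
    using eventually_gt_at_top[of "nat \<lceil>norm p\<rceil>"] by eventually_elim (rule ev, linarith)
  ultimately have "(\<lambda>n. I n - - (2 * pi * deriv F p)) \<longlonglongrightarrow> 0"
    by (rule Lim_null_comparison[rotated])
  then have "I \<longlonglongrightarrow> - (2 * pi * deriv F p)"
    by (rule LIM_zero_cancel)
  with lim1 show "(LINT y|lborel. ?g y) = - (2 * pi * deriv F p)"
    by (rule LIMSEQ_unique)
qed

section \<open>The reproducing formula on the half plane\<close>

lemma half_plane_kernel_square_integrable:
  assumes q: "0 < Re q"
  shows "(\<integral>\<^sup>+p. ennreal (indicator {0<..} (fst p) * (norm (1 / (q + cnj (Complex (fst p) (snd p)))\<^sup>2))\<^sup>2)
    \<partial>(lborel :: (real \<times> real) measure)) < \<infinity>"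
    (is "(\<integral>\<^sup>+p. ennreal (?k p) \<partial>_) < _")
proof -
  \<comment> \<open>The integrand is |q + cnj w|^(-4). One factor |q + cnj w|^2 is bounded below by
    \<open>(Re q + x)^2\<close>, the other by \<open>(Re q)^2 + (y - Im q)^2\<close>. This majorant
    separates the variables, and each one-dimensional integral is finite.\<close>
  define u where "u x = ennreal (1 / (Re q + x)\<^sup>2) * indicator {0..} x" for x
  define v where "v y = ennreal (1 / ((Re q)\<^sup>2 + (y - Im q)\<^sup>2))" for y
  have [measurable]: "u \<in> borel_measurable borel" "v \<in> borel_measurable borel"
    unfolding u_def v_def by measurable
  have "((\<lambda>x. - 1 / (Re q + x)) \<longlongrightarrow> 0) at_top"
    by real_asymp
  then have "integral\<^sup>N lborel u = ennreal (0 - (- 1 / (Re q + 0)))"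
    unfolding u_def using q
    by (intro nn_integral_FTC_atLeast)
      (auto intro!: derivative_eq_intros simp: power2_eq_square)
  then have U: "integral\<^sup>N lborel u < \<infinity>" by simp
  have V: "integral\<^sup>N lborel v < \<infinity>"
    unfolding v_def using integrable_inverse_add_square[OF q, of "Im q"]
    by (subst nn_integral_eq_integral) auto
  have le: "ennreal (?k (x, y)) \<le> u x * v y" for x y
  proof (cases "0 < x")
    case True
    let ?n = "norm (q + cnj (Complex x y))"
    have n: "?n\<^sup>2 = (Re q + x)\<^sup>2 + (y - Im q)\<^sup>2"
      by (simp add: cmod_power2 power2_commute)
    have "(Re q)\<^sup>2 \<le> (Re q + x)\<^sup>2"
      using q True by (intro power_mono) auto
    then have "(Re q + x)\<^sup>2 * ((Re q)\<^sup>2 + (y - Im q)\<^sup>2) \<le> ?n\<^sup>2 * ?n\<^sup>2"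
      unfolding n by (intro mult_mono) auto
    then have "1 / (?n\<^sup>2 * ?n\<^sup>2) \<le> 1 / ((Re q + x)\<^sup>2 * ((Re q)\<^sup>2 + (y - Im q)\<^sup>2))"
      using q True by (intro divide_left_mono mult_pos_pos add_pos_nonneg) (auto simp: n add_pos_nonneg)
    then have "?k (x, y) \<le> 1 / (Re q + x)\<^sup>2 * (1 / ((Re q)\<^sup>2 + (y - Im q)\<^sup>2))"
      using True by (simp add: norm_divide norm_mult power2_eq_square)
    then have "ennreal (?k (x, y)) \<le> ennreal (1 / (Re q + x)\<^sup>2 * (1 / ((Re q)\<^sup>2 + (y - Im q)\<^sup>2)))"
      by (rule ennreal_leI)
    also have "\<dots> = u x * v y"
      using True unfolding u_def v_def by (subst ennreal_mult) auto
    finally show ?thesis .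
  qed auto
  have meas: "(\<lambda>p. u (fst p) * v (snd p)) \<in> borel_measurable (borel \<Otimes>\<^sub>M borel)"
    by measurable
  have "(\<integral>\<^sup>+p. ennreal (?k p) \<partial>lborel) \<le> (\<integral>\<^sup>+p. u (fst p) * v (snd p) \<partial>lborel)"
    using le by (intro nn_integral_mono) auto
  also have "\<dots> = (\<integral>\<^sup>+x. \<integral>\<^sup>+y. u x * v y \<partial>lborel \<partial>lborel)"
    using meas lborel.nn_integral_fst[of "\<lambda>p. u (fst p) * v (snd p)" lborel] by (simp add: lborel_prod borel_prod)
  also have "\<dots> = integral\<^sup>N lborel u * integral\<^sup>N lborel v"
    by (simp add: nn_integral_cmult nn_integral_multc)
  also have "\<dots> < \<infinity>"
    using U V by (simp add: ennreal_mult_less_top)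
  finally show ?thesis .
qed

text \<open>The half side Re z / 2 keeps the squares around z inside the half plane. Its square and
  the factor 4 of \<open>bergman_point_estimate\<close> account for the 16 in the constant.\<close>

lemma bergman_decay:
  fixes F :: "complex \<Rightarrow> complex"
  assumes F: "F holomorphic_on {z. 0 < Re z}"
    and fin: "(\<integral>\<^sup>+p. ennreal (indicator {0<..} (fst p) * (norm (F (Complex (fst p) (snd p))))\<^sup>2)
      \<partial>(lborel :: (real \<times> real) measure)) < \<infinity>"
  obtains K where "0 \<le> K" "\<And>z. 0 < Re z \<Longrightarrow> norm (F z) \<le> K / Re z"
proof -
  obtain m where m: "0 \<le> m" "(\<integral>\<^sup>+p. ennreal (indicator {0<..} (fst p) * (norm (F (Complex (fst p) (snd p))))\<^sup>2)
      \<partial>(lborel :: (real \<times> real) measure)) = ennreal m"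
    using fin by (auto elim: less_top_ennreal[THEN iffD1, THEN exE])
  have "norm (F z) \<le> sqrt (16 * m / pi) / Re z" if z: "0 < Re z" for z
  proof -
    have "ennreal (pi * (Re z / 2)\<^sup>2 * (norm (F z))\<^sup>2) \<le> 4 * ennreal m"
      using bergman_point_estimate[OF F, of "Re z / 2" z] z m by simp
    also have "4 * ennreal m = ennreal (4 * m)"
      using m(1) by (simp add: ennreal_mult)
    finally have "pi * (Re z / 2)\<^sup>2 * (norm (F z))\<^sup>2 \<le> 4 * m"
      using m(1) by (simp add: ennreal_le_iff)
    then have "(norm (F z))\<^sup>2 \<le> 16 * m / pi / (Re z)\<^sup>2"
      using z by (simp add: field_simps power2_eq_square)
    then have "norm (F z) \<le> sqrt (16 * m / pi / (Re z)\<^sup>2)"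
      by (rule real_le_rsqrt)
    then show ?thesis
      using z by (simp add: real_sqrt_divide real_sqrt_mult)
  qed
  then show ?thesis
    using m(1) by (intro that[of "sqrt (16 * m / pi)"]) auto
qed

text \<open>The decay of F serves twice: it bounds F by \<open>K / x\<close> to the right of the
  line Re w = x, as Cauchy's formula on that line requires, and it removes the boundary term of the
  outer integral at infinity.\<close>

lemma half_plane_bergman_reproducing:
  fixes F :: "complex \<Rightarrow> complex"
  assumes F: "F holomorphic_on {z. 0 < Re z}"
    and fin: "(\<integral>\<^sup>+p. ennreal (indicator {0<..} (fst p) * (norm (F (Complex (fst p) (snd p))))\<^sup>2)
      \<partial>(lborel :: (real \<times> real) measure)) < \<infinity>"
    and q: "0 < Re q"
  shows "(LINT p|(lborel :: (real \<times> real) measure). indicator {0<..} (fst p) *\<^sub>R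
      (F (Complex (fst p) (snd p)) / (q + cnj (Complex (fst p) (snd p)))\<^sup>2)) = pi * F q"
proof -
  let ?w = "\<lambda>p::real\<times>real. Complex (fst p) (snd p)"
  let ?f = "\<lambda>p. indicator {0<..} (fst p) *\<^sub>R (F (?w p) / (q + cnj (?w p))\<^sup>2)"
  let ?k = "\<lambda>p. indicator {0<..} (fst p) * (norm (1 / (q + cnj (?w p))\<^sup>2))\<^sup>2"
  let ?n = "\<lambda>p. indicator {0<..} (fst p) * (norm (F (?w p)))\<^sup>2"
  obtain K where K: "0 \<le> K" "\<And>z. 0 < Re z \<Longrightarrow> norm (F z) \<le> K / Re z"
    using bergman_decay[OF F fin] by blast
  have ne: "q + cnj z \<noteq> 0" if "0 < Re z" for z
    using q that by (auto simp: complex_eq_iff)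
  have contF: "continuous_on {z. 0 < Re z} F"
    using F by (rule holomorphic_on_imp_continuous_on)
  have contk: "continuous_on {z. 0 < Re z} (\<lambda>z. 1 / (q + cnj z)\<^sup>2)"
    using ne by (intro continuous_intros) auto
  have "continuous_on {z. 0 < Re z} (\<lambda>z. F z / (q + cnj z)\<^sup>2)"
    using ne by (intro continuous_intros contF) auto
  then have mf: "?f \<in> borel_measurable borel"
    by (rule measurable_half_plane)
  have n_eq: "?n p = (norm (indicator {0<..} (fst p) *\<^sub>R F (?w p)))\<^sup>2" for p
    by (auto simp: indicator_def)
  have mn: "?n \<in> borel_measurable borel"
    unfolding n_eq using measurable_half_plane[OF contF] by measurable
  have k_eq: "?k p = (norm (indicator {0<..} (fst p) *\<^sub>R (1 / (q + cnj (?w p))\<^sup>2)))\<^sup>2" for p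
    by (auto simp: indicator_def)
  have mk: "?k \<in> borel_measurable borel"
    unfolding k_eq using measurable_half_plane[OF contk] by measurable
  \<comment> \<open>Fubini needs the product of F and the kernel to be integrable. Both factors are
    square integrable, and |a b| is at most (a^2 + b^2) / 2.\<close>
  have "integrable lborel ?n" "integrable lborel ?k"
    using mn mk fin half_plane_kernel_square_integrable[OF q] by (auto intro!: integrableI_nonneg)
  then have "integrable lborel (\<lambda>p. (?n p + ?k p) / 2)"
    by (intro integrable_divide_zero Bochner_Integration.integrable_add)
  then have int: "integrable lborel ?f"
  proof (rule Bochner_Integration.integrable_bound)
    show "AE p in lborel. norm (?f p) \<le> norm ((?n p + ?k p) / 2)"
    proof (rule AE_I2)
      fix p :: "real \<times> real"
      let ?a = "norm (F (?w p))" and ?b = "norm (1 / (q + cnj (?w p))\<^sup>2)"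
      have "0 \<le> (?a - ?b)\<^sup>2" by simp
      then have "?a * ?b \<le> (?a\<^sup>2 + ?b\<^sup>2) / 2"
        by (simp add: power2_diff)
      moreover have "norm (F (?w p) / (q + cnj (?w p))\<^sup>2) = ?a * ?b"
        by (simp add: norm_divide)
      ultimately show "norm (?f p) \<le> norm ((?n p + ?k p) / 2)"
        by (auto simp: indicator_def)
    qed
  qed (use mf in simp)
  define J where "J = (\<lambda>x::real. LINT y|lborel. ?f (x, y))"
  have J: "J x = - (2 * pi * deriv F (q + 2 * x))" if x: "0 < x" for x
  proof -
    have "norm (F z) \<le> K / x" if "x \<le> Re z" for z
      using K(2)[of z] K(1) x that by (meson divide_left_mono less_le_trans mult_pos_pos order_trans)
    then have "(LINT y|lborel. F (Complex x y) / (Complex x y - (q + 2 * x))\<^sup>2) = - (2 * pi * deriv F (q + 2 * x))"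
      using x q by (intro vertical_line_integral_double_pole[OF F x]) auto
    moreover have "(Complex x y - (q + 2 * x))\<^sup>2 = (q + cnj (Complex x y))\<^sup>2" for y
    proof -
      have "Complex x y - (q + 2 * x) = - (q + cnj (Complex x y))"
        by (simp add: complex_eq_iff)
      then show ?thesis by (simp only: power2_minus)
    qed
    ultimately show ?thesis
      using x by (simp add: J_def)
  qed
  have int': "integrable (lborel \<Otimes>\<^sub>M lborel) ?f"
    using int by (simp add: lborel_prod)
  have intJ: "integrable lborel J"
    using lborel_pair.integrable_fst'[OF int'] unfolding J_def .
  have eqJ: "(LINT p|lborel. ?f p) = (LINT x|lborel. J x)"
    using lborel_pair.integral_fst'[OF int'] by (simp add: J_def lborel_prod)
  \<comment> \<open>The fundamental theorem is applied on bounded intervals only; the limit in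
    \<open>y\<close> is taken afterwards, \<open>{..y}\<close> being the form that
    \<open>tendsto_integral_at_top\<close> expects. The point 0 is excluded as a null set: there
    \<open>J\<close> vanishes because of the open half line in the integrand, while the derivative
    of F need not.\<close>
  have cumulative: "(LINT x|lborel. indicator {..y} x *\<^sub>R J x) = pi * F q - pi * F (q + 2 * of_real y)" if y: "0 \<le> y" for y :: real
  proof -
    let ?d = "\<lambda>x. - (2 * pi * deriv F (q + 2 * of_real x))"
    have "AE x in lborel. x \<noteq> (0::real)"
      by (rule AE_lborel_singleton)
    then have "AE x in lborel. indicator {..y} x *\<^sub>R J x = indicator {0..y} x *\<^sub>R ?d x"
    proof eventually_elim
      fix x :: real assume x: "x \<noteq> 0"
      show "indicator {..y} x *\<^sub>R J x = indicator {0..y} x *\<^sub>R ?d x"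
      proof (cases "0 < x")
        case False
        then have "J x = 0" by (simp add: J_def)
        with False x show ?thesis by simp
      qed (simp add: J indicator_def)
    qed
    moreover have contd: "continuous_on {0..y} ?d"
    proof -
      have "continuous_on {z. 0 < Re z} (deriv F)"
        by (intro holomorphic_on_imp_continuous_on holomorphic_deriv[OF F]) (simp add: open_halfspace_Re_gt)
      then have "continuous_on {0..y} (\<lambda>x. deriv F (q + 2 * of_real x))"
        by (rule continuous_on_compose2) (use q in \<open>auto intro!: continuous_intros\<close>)
      then show ?thesis by (intro continuous_intros)
    qed
    moreover have "(LINT x|lborel. indicator {0..y} x *\<^sub>R ?d x) = - (pi * F (q + 2 * of_real y)) - - (pi * F (q + 2 * of_real 0))"
    proof (rule integral_FTC_atLeastAtMost[OF y _ contd])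
      fix x assume x: "0 \<le> x" "x \<le> y"
      have "(F has_field_derivative deriv F (q + 2 * of_real x)) (at (q + 2 * of_real x))"
        using F x q by (intro holomorphic_derivI[of F "{z. 0 < Re z}"]) (auto simp: open_halfspace_Re_gt)
      moreover have "((\<lambda>x. q + 2 * of_real x) has_vector_derivative 2) (at x within {0..y})"
        by (auto intro!: derivative_eq_intros simp: has_vector_derivative_def scaleR_conv_of_real)
      ultimately have "((F \<circ> (\<lambda>x. q + 2 * of_real x)) has_vector_derivative 2 * deriv F (q + 2 * of_real x)) (at x within {0..y})"
        by (rule field_vector_diff_chain_within[rotated, OF has_field_derivative_at_within])
      then show "((\<lambda>x. - (pi * F (q + 2 * of_real x))) has_vector_derivative ?d x) (at x within {0..y})"
        by (auto simp: o_def intro!: derivative_eq_intros)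
    qed
    moreover have "(\<lambda>x. indicator {0..y} x *\<^sub>R ?d x) \<in> borel_measurable borel"
      by (intro borel_measurable_continuous_on_indicator contd) simp
    ultimately show ?thesis
      using intJ
      by (subst integral_cong_AE[where g = "\<lambda>x. indicator {0..y} x *\<^sub>R ?d x"]) auto
  qed
  have "((\<lambda>y. LINT x|lborel. indicator {..y} x *\<^sub>R J x) \<longlongrightarrow> (LINT x|lborel. J x)) at_top"
    using intJ by (intro tendsto_integral_at_top) auto
  moreover have "((\<lambda>y. LINT x|lborel. indicator {..y} x *\<^sub>R J x) \<longlongrightarrow> pi * F q - of_real pi * 0) at_top"
  proof (rule Lim_transform_eventually)
    have "((\<lambda>y. K / (Re q + 2 * y)) \<longlongrightarrow> 0) at_top"
      by real_asymp
    moreover have "\<forall>\<^sub>F y in at_top. norm (F (q + 2 * of_real y)) \<le> K / (Re q + 2 * y)"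
      using eventually_ge_at_top[of 0]
    proof eventually_elim
      fix y :: real assume "0 \<le> y"
      then show "norm (F (q + 2 * of_real y)) \<le> K / (Re q + 2 * y)"
        using K(2)[of "q + 2 * of_real y"] q by simp
    qed
    ultimately have "((\<lambda>y. F (q + 2 * of_real y)) \<longlongrightarrow> 0) at_top"
      by (rule Lim_null_comparison[rotated])
    then show "((\<lambda>y. pi * F q - pi * F (q + 2 * of_real y)) \<longlongrightarrow> pi * F q - of_real pi * 0) at_top"
      by (intro tendsto_intros)
    show "\<forall>\<^sub>F y in at_top. pi * F q - pi * F (q + 2 * of_real y) = (LINT x|lborel. indicator {..y} x *\<^sub>R J x)"
      using eventually_ge_at_top[of 0] by eventually_elim (simp add: cumulative)
  qed
  ultimately have "(LINT x|lborel. J x) = pi * F q - of_real pi * 0"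
    by (rule tendsto_unique[rotated]) simp
  then show ?thesis
    using eqJ by simp
qed

section \<open>Slice regular functions on the right half space\<close>

lemma quat_sel [simp]:
  "qRe 0 = 0" "qIm1 0 = 0" "qIm2 0 = 0" "qIm3 0 = 0"
  "qRe 1 = 1" "qIm1 1 = 0" "qIm2 1 = 0" "qIm3 1 = 0"
  "qRe (p + q) = qRe p + qRe q" "qIm1 (p + q) = qIm1 p + qIm1 q"
  "qIm2 (p + q) = qIm2 p + qIm2 q" "qIm3 (p + q) = qIm3 p + qIm3 q"
  "qRe (p - q) = qRe p - qRe q" "qIm1 (p - q) = qIm1 p - qIm1 q"
  "qIm2 (p - q) = qIm2 p - qIm2 q" "qIm3 (p - q) = qIm3 p - qIm3 q"
  "qRe (- q) = - qRe q" "qIm1 (- q) = - qIm1 q"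
  "qIm2 (- q) = - qIm2 q" "qIm3 (- q) = - qIm3 q"
  "qRe (c *\<^sub>R q) = c * qRe q" "qIm1 (c *\<^sub>R q) = c * qIm1 q"
  "qIm2 (c *\<^sub>R q) = c * qIm2 q" "qIm3 (c *\<^sub>R q) = c * qIm3 q"
  "qRe (qcnj q) = qRe q" "qIm1 (qcnj q) = - qIm1 q"
  "qIm2 (qcnj q) = - qIm2 q" "qIm3 (qcnj q) = - qIm3 q"
  by (simp_all add: zero_quat_def one_quat_def plus_quat_def minus_quat_def uminus_quat_def
      scaleR_quat_def qcnj_def)

lemma quat_sel_mult:
  "qRe (p * q) = qRe p * qRe q - qIm1 p * qIm1 q - qIm2 p * qIm2 q - qIm3 p * qIm3 q"
  "qIm1 (p * q) = qRe p * qIm1 q + qIm1 p * qRe q + qIm2 p * qIm3 q - qIm3 p * qIm2 q"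
  "qIm2 (p * q) = qRe p * qIm2 q - qIm1 p * qIm3 q + qIm2 p * qRe q + qIm3 p * qIm1 q"
  "qIm3 (p * q) = qRe p * qIm3 q + qIm1 p * qIm2 q - qIm2 p * qIm1 q + qIm3 p * qRe q"
  by (simp_all add: times_quat_def)

lemma quat_sel_of_real [simp]:
  "qRe (of_real c) = c" "qIm1 (of_real c) = 0" "qIm2 (of_real c) = 0" "qIm3 (of_real c) = 0"
  by (simp_all add: of_real_def)

lemma inner_one_quat [simp]: "inner 1 (1 :: quat) = 1"
  by (simp add: inner_quat_def)

lemma qRe_eq_inner: "qRe q = inner q 1"
  by (simp add: inner_quat_def)

lemma qcnj_mult_self: "qcnj q * q = of_real ((norm q)\<^sup>2)" "q * qcnj q = of_real ((norm q)\<^sup>2)"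
  by (simp_all add: quat_eq_iff quat_sel_mult norm_quat_def power2_eq_square)

lemma qcnj_diff: "qcnj (p - q) = qcnj p - qcnj q"
  by (simp add: quat_eq_iff)

lemma norm_qcnj [simp]: "norm (qcnj q) = norm q"
  by (simp add: norm_quat_def)

lemma bounded_linear_qcnj: "bounded_linear qcnj"
  by (rule bounded_linear_intro[where K = 1]) (simp_all add: quat_eq_iff)

lemma open_right_half_space: "open right_half_space"
proof -
  have "right_half_space = {q. 0 < inner 1 q}"
    by (simp add: right_half_space_def inner_quat_def)
  then show ?thesis using open_halfspace_gt[of 0 "1 :: quat"] by simp
qed

section \<open>Slices as copies of the complex plane\<close>

definition slice_emb :: "quat \<Rightarrow> complex \<Rightarrow> quat" where
  "slice_emb i z = slice_point i (Re z) (Im z)"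

text \<open>For an imaginary unit \<open>i\<close> this is the orthogonal projection onto the slice
  of \<open>i\<close>, read off in complex coordinates, and a left inverse of
  \<open>slice_emb i\<close>.\<close>

definition slice_proj :: "quat \<Rightarrow> quat \<Rightarrow> complex" where
  "slice_proj i v = Complex (inner v 1) (inner v i)"

lemma slice_emb_scaleR: "slice_emb i z = Re z *\<^sub>R 1 + Im z *\<^sub>R i"
  by (simp add: slice_emb_def slice_point_def scaleR_conv_of_real)

lemma slice_point_eq_emb: "slice_point i x y = slice_emb i (Complex x y)"
  by (simp add: slice_emb_def)

lemma bounded_linear_slice_emb: "bounded_linear (slice_emb i)"
proof -
  have "bounded_linear (\<lambda>z. Re z *\<^sub>R 1 + Im z *\<^sub>R i)"
    by (intro bounded_linear_add bounded_linear_compose[OF bounded_linear_scaleR_left]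
        bounded_linear_Re bounded_linear_Im)
  then show ?thesis by (simp add: slice_emb_scaleR[abs_def])
qed

lemma bounded_linear_slice_proj: "bounded_linear (slice_proj i)"
proof -
  have "bounded_linear (\<lambda>v. of_real (inner v 1) + of_real (inner v i) * \<i>)"
    by (intro bounded_linear_add bounded_linear_compose[OF bounded_linear_of_real]
        bounded_linear_inner_left bounded_linear_mult_const
        bounded_linear_compose[OF bounded_linear_of_real bounded_linear_inner_left])
  then show ?thesis by (simp add: slice_proj_def[abs_def] Complex_eq mult.commute)
qed

lemmas slice_emb_linear_simps [simp] =
  linear_simps[OF bounded_linear_slice_emb]

lemma slice_emb_of_real [simp]: "slice_emb i (of_real x) = of_real x"
  by (simp add: slice_emb_def slice_point_def)

lemma slice_emb_one [simp]: "slice_emb i 1 = 1"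
  using slice_emb_of_real[of i 1] by simp

lemma slice_emb_ii [simp]: "slice_emb i \<i> = i"
  by (simp add: slice_emb_def slice_point_def)

lemma slice_emb_numeral [simp]: "slice_emb i (numeral n) = numeral n"
  using slice_emb_of_real[of i "numeral n"] by simp

lemma imag_unit_sphere_simps:
  assumes "i \<in> imag_unit_sphere"
  shows "qRe i = 0" "norm i = 1" "i * i = -1" "inner i i = 1" "inner 1 i = 0" "inner i 1 = 0"
    "(qIm1 i)\<^sup>2 + (qIm2 i)\<^sup>2 + (qIm3 i)\<^sup>2 = 1"
proof -
  show 1: "qRe i = 0" "norm i = 1"
    using assms by (simp_all add: imag_unit_sphere_def)
  then show s: "(qIm1 i)\<^sup>2 + (qIm2 i)\<^sup>2 + (qIm3 i)\<^sup>2 = 1"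
    by (simp add: norm_quat_def)
  show "i * i = -1"
    using 1 s by (simp add: quat_eq_iff quat_sel_mult power2_eq_square)
  show "inner i i = 1" "inner 1 i = 0" "inner i 1 = 0"
    using 1 by (simp_all add: dot_square_norm) (simp_all add: inner_quat_def)
qed

context
  fixes i :: quat
  assumes i: "i \<in> imag_unit_sphere"
begin

lemma slice_emb_mult: "slice_emb i (z * w) = slice_emb i z * slice_emb i w"
  by (simp add: slice_emb_scaleR algebra_simps imag_unit_sphere_simps(3)[OF i])

lemma slice_emb_power: "slice_emb i (z ^ n) = slice_emb i z ^ n"
  by (induction n) (simp_all add: slice_emb_mult)

lemma slice_emb_cnj: "slice_emb i (cnj z) = qcnj (slice_emb i z)"
  using imag_unit_sphere_simps(1)[OF i] by (simp add: quat_eq_iff slice_emb_scaleR)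

lemma norm_slice_emb: "norm (slice_emb i z) = norm z"
proof -
  have "(norm (slice_emb i z))\<^sup>2 = (norm z)\<^sup>2"
    using imag_unit_sphere_simps[OF i]
    by (subst power2_norm_eq_inner, subst cmod_power2)
      (simp add: slice_emb_scaleR inner_simps power2_eq_square)
  then show ?thesis by simp
qed

lemma slice_emb_inverse: "slice_emb i (inverse z) = inverse (slice_emb i z)"
proof (cases "z = 0")
  case False
  then have "slice_emb i z * slice_emb i (inverse z) = 1"
    by (simp flip: slice_emb_mult)
  then show ?thesis
    using inverse_unique by metis
qed simp

lemma qRe_slice_emb [simp]: "qRe (slice_emb i z) = Re z"
  using imag_unit_sphere_simps(1)[OF i] by (simp add: slice_emb_scaleR)

lemma slice_emb_half_space: "slice_emb i z \<in> right_half_space \<longleftrightarrow> 0 < Re z"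
  by (simp add: right_half_space_def)

text \<open>Left multiplication by an element of the slice preserves the slice and its orthogonal
  complement, so it commutes with the projection. Right multiplication by a general quaternion does
  not; this asymmetry is what makes the constants on the right useful.\<close>

lemma slice_proj_mult: "slice_proj i (slice_emb i z * v) = z * slice_proj i v"
proof -
  have 1: "inner (i * v) 1 = - inner v i"
    using imag_unit_sphere_simps(1)[OF i] by (simp add: inner_quat_def quat_sel_mult algebra_simps)
  have "inner (i * v) i = qRe v * ((qIm1 i)\<^sup>2 + (qIm2 i)\<^sup>2 + (qIm3 i)\<^sup>2)"
    using imag_unit_sphere_simps(1)[OF i]
    by (simp add: inner_quat_def quat_sel_mult algebra_simps power2_eq_square)
  then have 2: "inner (i * v) i = inner v 1"
    by (simp add: imag_unit_sphere_simps(7)[OF i] inner_quat_def)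
  show ?thesis
    by (simp add: slice_proj_def slice_emb_scaleR complex_eq_iff inner_simps distrib_right 1 2)
qed

text \<open>Bessel's inequality for the orthonormal pair 1, \<open>i\<close>.\<close>

lemma norm_slice_proj_le: "norm (slice_proj i v) \<le> norm v"
proof -
  let ?u = "inner v 1 *\<^sub>R 1 + inner v i *\<^sub>R i"
  have "0 \<le> inner (v - ?u) (v - ?u)" by simp
  also have "\<dots> = inner v v - (inner v 1)\<^sup>2 - (inner v i)\<^sup>2"
    using imag_unit_sphere_simps(4-6)[OF i]
    by (simp add: inner_simps inner_commute[of 1 v] inner_commute[of i v] power2_eq_square algebra_simps)
  finally have "(norm (slice_proj i v))\<^sup>2 \<le> (norm v)\<^sup>2"
    by (simp add: slice_proj_def cmod_power2 power2_norm_eq_inner)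
  then show ?thesis by (simp add: power2_le_iff_abs_le)
qed

lemma slice_proj_emb: "slice_proj i (slice_emb i z) = z"
  using slice_proj_mult[of z 1] imag_unit_sphere_simps[OF i]
  by (simp add: slice_proj_def complex_eq_iff)

lemma slice_plane_eq: "slice_plane i = range (slice_emb i)"
  by (auto simp: slice_plane_def slice_point_eq_emb) (metis complex.exhaust_sel)

lemma closed_slice_plane: "closed (slice_plane i)"
proof -
  have "slice_plane i = {q. slice_emb i (slice_proj i q) = q}"
    by (auto simp: slice_plane_eq slice_proj_emb) (metis rangeI)
  moreover have "closed {q. slice_emb i (slice_proj i q) = q}"
    by (intro closed_Collect_eq continuous_intros linear_continuous_on
        bounded_linear_compose[OF bounded_linear_slice_emb bounded_linear_slice_proj])
  ultimately show ?thesis by simp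
qed

end

text \<open>One projection alone misses part of \<open>u - v\<close>. Multiplying on the right by
  the conjugate of \<open>u - v\<close> turns it into the real number |u - v|^2, which the real part
  of the projection detects.\<close>

lemma slice_proj_mult_eqI:
  assumes "\<And>c. slice_proj i (u * c) = slice_proj i (v * c)"
  shows "u = v"
proof -
  let ?c = "qcnj (u - v)"
  have "slice_proj i ((u - v) * ?c) = 0"
    using assms[of ?c] by (simp add: left_diff_distrib linear_simps[OF bounded_linear_slice_proj])
  then have "inner (of_real ((norm (u - v))\<^sup>2) :: quat) 1 = 0"
    unfolding qcnj_mult_self by (simp add: slice_proj_def complex_eq_iff)
  then have "qRe (of_real ((norm (u - v))\<^sup>2)) = 0"
    by (simp only: qRe_eq_inner)
  then show ?thesis
    unfolding quat_sel_of_real by simp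
qed

lemma exists_slice_emb:
  obtains i z where "i \<in> imag_unit_sphere" "q = slice_emb i z"
proof -
  define n where "n = sqrt ((qIm1 q)\<^sup>2 + (qIm2 q)\<^sup>2 + (qIm3 q)\<^sup>2)"
  show ?thesis
  proof (cases "n = 0")
    case True
    then have "qIm1 q = 0" "qIm2 q = 0" "qIm3 q = 0"
      by (auto simp: n_def add_nonneg_eq_0_iff)
    then show ?thesis
      \<comment> \<open>A real quaternion lies on every slice, so an arbitrary unit serves.\<close>
      by (intro that[of "Quat 0 1 0 0" "of_real (qRe q)"])
        (auto simp: imag_unit_sphere_def norm_quat_def quat_eq_iff)
  next
    case False
    define i where "i = Quat 0 (qIm1 q / n) (qIm2 q / n) (qIm3 q / n)"
    have "n\<^sup>2 = (qIm1 q)\<^sup>2 + (qIm2 q)\<^sup>2 + (qIm3 q)\<^sup>2"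
      by (simp add: n_def)
    then have "(qIm1 q / n)\<^sup>2 + (qIm2 q / n)\<^sup>2 + (qIm3 q / n)\<^sup>2 = 1"
      using False by (simp add: power_divide flip: add_divide_distrib \<open>n\<^sup>2 = _\<close>)
    then have "i \<in> imag_unit_sphere"
      by (simp add: imag_unit_sphere_def i_def norm_quat_def)
    moreover have "q = slice_emb i (Complex (qRe q) n)"
      using False by (simp add: quat_eq_iff slice_emb_scaleR i_def)
    ultimately show ?thesis by (rule that)
  qed
qed

section \<open>Slice regularity as holomorphy\<close>

lemma vector_derivative_slice:
  assumes i: "i \<in> imag_unit_sphere" and f: "(f has_derivative D) (at (slice_point i x y))"
  shows "vector_derivative (\<lambda>t. f (slice_point i t y)) (at x) = D 1"
    "vector_derivative (\<lambda>t. f (slice_point i x t)) (at y) = D i"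
proof -
  have lin: "D (t *\<^sub>R v) = t *\<^sub>R D v" for t v
    using has_derivative_linear[OF f] by (rule linear_cmul)
  have "((\<lambda>t. slice_point i t y) has_derivative (\<lambda>t. t *\<^sub>R 1)) (at x)"
    unfolding slice_point_eq_emb slice_emb_scaleR by (auto intro!: derivative_eq_intros)
  from has_derivative_compose[OF this f] show "vector_derivative (\<lambda>t. f (slice_point i t y)) (at x) = D 1"
    by (intro vector_derivative_at) (simp add: has_vector_derivative_def lin)
  have "((\<lambda>t. slice_point i x t) has_derivative (\<lambda>t. t *\<^sub>R i)) (at y)"
    unfolding slice_point_eq_emb slice_emb_scaleR by (auto intro!: derivative_eq_intros)
  from has_derivative_compose[OF this f] show "vector_derivative (\<lambda>t. f (slice_point i x t)) (at y) = D i"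
    by (intro vector_derivative_at) (simp add: has_vector_derivative_def lin)
qed

text \<open>The Cauchy-Riemann equation D 1 + i D i = 0 says that the differential D, restricted to
  the slice, is left complex linear, that is, h is sent to h * d with d = D 1. This form composes
  with linear maps and is closed under sums, whereas \<open>vector_derivative\<close> has to be
  evaluated by way of differentiability each time.\<close>

lemma slice_regular_half_space_iff:
  "f \<in> slice_regular right_half_space \<longleftrightarrow>
    f \<in> extensional right_half_space \<and> f differentiable_on right_half_space \<and>
    (\<forall>i\<in>imag_unit_sphere. \<forall>z. 0 < Re z \<longrightarrow>
      (\<exists>d. ((\<lambda>z. f (slice_emb i z)) has_derivative (\<lambda>h. slice_emb i h * d)) (at z)))"
proof -
  have "(\<forall>x y. slice_point i x y \<in> right_half_space \<longrightarrow>
        vector_derivative (\<lambda>t. f (slice_point i t y)) (at x)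
        + i * vector_derivative (\<lambda>t. f (slice_point i x t)) (at y) = 0) \<longleftrightarrow>
      (\<forall>z. 0 < Re z \<longrightarrow>
        (\<exists>d. ((\<lambda>z. f (slice_emb i z)) has_derivative (\<lambda>h. slice_emb i h * d)) (at z)))"
    (is "(\<forall>x y. _ \<longrightarrow> ?L x y) \<longleftrightarrow> (\<forall>z. _ \<longrightarrow> ?R z)")
    if diff: "f differentiable_on right_half_space" and i: "i \<in> imag_unit_sphere" for i
  proof -
    have "?L x y \<longleftrightarrow> ?R (Complex x y)" if x: "0 < x" for x y
    proof -
      let ?z = "Complex x y"
      have "slice_emb i ?z \<in> right_half_space"
        using x by (simp add: slice_emb_half_space[OF i])
      then obtain D where D: "(f has_derivative D) (at (slice_emb i ?z))"
        using diff open_right_half_space unfolding differentiable_on_def differentiable_def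
        by (metis at_within_open)
      have emb: "(slice_emb i has_derivative slice_emb i) (at ?z)"
        by (rule bounded_linear_imp_has_derivative[OF bounded_linear_slice_emb])
      have comp: "((\<lambda>z. f (slice_emb i z)) has_derivative (\<lambda>h. D (slice_emb i h))) (at ?z)"
        by (rule has_derivative_compose[OF emb D])
      have split: "D (slice_emb i h) = Re h *\<^sub>R D 1 + Im h *\<^sub>R D i" for h
        using has_derivative_linear[OF D] by (simp add: slice_emb_scaleR linear_add linear_cmul)
      have L: "?L x y \<longleftrightarrow> D 1 + i * D i = 0"
        using D unfolding slice_point_eq_emb[symmetric] by (simp add: vector_derivative_slice[OF i])
      have ii: "i * (i * v) = - v" for v
        using imag_unit_sphere_simps(3)[OF i] by (simp flip: mult.assoc)
      show ?thesis
      proof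
        assume "?L x y"
        then have "i * (D 1 + i * D i) = 0" using L by simp
        then have "D i = i * D 1" by (simp add: distrib_left ii)
        then have "(\<lambda>h. D (slice_emb i h)) = (\<lambda>h. slice_emb i h * D 1)"
          by (simp add: split) (simp add: slice_emb_scaleR distrib_right)
        then show "?R ?z" using comp by auto
      next
        assume "?R ?z"
        then obtain d where "((\<lambda>z. f (slice_emb i z)) has_derivative (\<lambda>h. slice_emb i h * d)) (at ?z)"
          by blast
        then have eq: "(\<lambda>h. D (slice_emb i h)) = (\<lambda>h. slice_emb i h * d)"
          using comp has_derivative_unique by blast
        show "?L x y"
          using fun_cong[OF eq, of 1] fun_cong[OF eq, of \<i>] by (simp add: L ii)
      qed
    qed
    then show ?thesis
      by (simp add: slice_point_eq_emb slice_emb_half_space[OF i]) (metis complex.exhaust_sel complex.sel(1))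
  qed
  then show ?thesis
    unfolding slice_regular_def by blast
qed

text \<open>With \<open>c\<close> on the right, the differential \<open>slice_emb i h * d\<close>
  keeps its complex factor on the left, where \<open>slice_proj_mult\<close> takes it out of the
  projection.\<close>

lemma slice_regular_holomorphic:
  assumes f: "f \<in> slice_regular right_half_space" and i: "i \<in> imag_unit_sphere"
  shows "(\<lambda>z. slice_proj i (f (slice_emb i z) * c)) holomorphic_on {z. 0 < Re z}"
proof -
  have "\<exists>d. ((\<lambda>z. slice_proj i (f (slice_emb i z) * c)) has_field_derivative d) (at z)"
    if z: "0 < Re z" for z
  proof -
    obtain d where d: "((\<lambda>z. f (slice_emb i z)) has_derivative (\<lambda>h. slice_emb i h * d)) (at z)"
      using f i z unfolding slice_regular_half_space_iff by blast
    have "bounded_linear (\<lambda>v. slice_proj i (v * c))"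
      by (rule bounded_linear_compose[OF bounded_linear_slice_proj bounded_linear_mult_left])
    from bounded_linear.has_derivative[OF this d]
    have "((\<lambda>z. slice_proj i (f (slice_emb i z) * c)) has_derivative (\<lambda>h. h * slice_proj i (d * c))) (at z)"
      by (simp add: mult.assoc slice_proj_mult[OF i])
    then show ?thesis
      unfolding has_field_derivative_def mult.commute[of _ "slice_proj i (d * c)"]
      by (rule exI)
  qed
  then show ?thesis
    by (auto simp: holomorphic_on_open open_halfspace_Re_gt)
qed

text \<open>The restriction to a second slice vanishes on the real half line, which all slices share.\<close>

lemma slice_regular_identity:
  assumes f: "f \<in> slice_regular right_half_space" and j: "j \<in> imag_unit_sphere"
    and zero: "\<And>z. 0 < Re z \<Longrightarrow> f (slice_emb j z) = 0" and q: "q \<in> right_half_space"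
  shows "f q = 0"
proof -
  obtain i z where i: "i \<in> imag_unit_sphere" and qz: "q = slice_emb i z"
    by (rule exists_slice_emb)
  have z: "0 < Re z" using q by (simp add: qz slice_emb_half_space[OF i])
  have "slice_proj i (f (slice_emb i z) * c) = slice_proj i (0 * c)" for c
  proof -
    let ?U = "of_real ` {0<..} :: complex set"
    \<comment> \<open>Analytic continuation asks for an accumulation point inside the domain; any
      positive real number would do.\<close>
    have lim: "1 islimpt ?U"
    proof -
      have "(\<lambda>n. complex_of_real (1 + 1 / Suc n)) \<longlonglongrightarrow> of_real (1 + 0)"
        by (intro tendsto_intros LIMSEQ_Suc[OF lim_1_over_n])
      then show ?thesis
        unfolding islimpt_sequential
        by (intro exI[of _ "\<lambda>n. complex_of_real (1 + 1 / Suc n)"])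
          (auto simp del: of_real_add of_real_divide simp: of_real_eq_1_iff add_pos_pos)
    qed
    have "slice_proj i (f (slice_emb i z) * c) = 0"
    proof (rule analytic_continuation[OF slice_regular_holomorphic[OF f i, of c]])
      show "open {z. 0 < Re z}" by (rule open_halfspace_Re_gt)
      show "connected {z. 0 < Re z}" by (intro convex_connected convex_halfspace_Re_gt)
      show "?U \<subseteq> {z. 0 < Re z}" by auto
      show "1 \<in> {z. 0 < Re z}" "z \<in> {z. 0 < Re z}" using z by auto
      show "1 islimpt ?U" by (rule lim)
    next
      fix u assume "u \<in> ?U"
      then obtain x where x: "0 < x" "u = of_real x" by auto
      then show "slice_proj i (f (slice_emb i u) * c) = 0"
        using zero[of "of_real x"] by (simp add: linear_simps[OF bounded_linear_slice_proj])
    qed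
    then show ?thesis by (simp add: linear_simps[OF bounded_linear_slice_proj])
  qed
  then show ?thesis
    unfolding qz by (rule slice_proj_mult_eqI)
qed

section \<open>The Bergman space of a slice\<close>

lemma borel_measurable_slice_emb: "(\<lambda>p. slice_emb j (Complex (fst p) (snd p))) \<in> borel_measurable (borel :: (real \<times> real) measure)"
  unfolding slice_emb_scaleR by (intro borel_measurable_continuous_onI continuous_intros)

lemma slice_measure_eq: "slice_measure j = distr lborel borel (\<lambda>p. slice_emb j (Complex (fst p) (snd p)))"
  by (simp add: slice_measure_def slice_point_eq_emb case_prod_unfold)

lemma slice_measurable:
  fixes g :: "quat \<Rightarrow> quat"
  assumes j: "j \<in> imag_unit_sphere" and g: "continuous_on right_half_space g"
  shows "(\<lambda>q. indicator (right_half_space \<inter> slice_plane j) q *\<^sub>R g q) \<in> borel_measurable borel"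
  by (intro borel_measurable_continuous_on_indicator continuous_on_subset[OF g] sets.Int
      borel_open[OF open_right_half_space] borel_closed[OF closed_slice_plane[OF j]]) auto

lemma slice_integral_eq:
  fixes g :: "quat \<Rightarrow> quat"
  assumes j: "j \<in> imag_unit_sphere" and g: "continuous_on right_half_space g"
  shows "(LINT q:right_half_space \<inter> slice_plane j|slice_measure j. g q) =
    (LINT p|lborel. indicator {0<..} (fst p) *\<^sub>R g (slice_emb j (Complex (fst p) (snd p))))"
proof -
  have "(LINT q:right_half_space \<inter> slice_plane j|slice_measure j. g q) =
    (LINT p|lborel. indicator (right_half_space \<inter> slice_plane j) (slice_emb j (Complex (fst p) (snd p)))
      *\<^sub>R g (slice_emb j (Complex (fst p) (snd p))))"
    unfolding set_lebesgue_integral_def slice_measure_eq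
    by (rule integral_distr) (use borel_measurable_slice_emb slice_measurable[OF j g] in auto)
  also have "\<dots> = (LINT p|lborel. indicator {0<..} (fst p) *\<^sub>R g (slice_emb j (Complex (fst p) (snd p))))"
    by (intro Bochner_Integration.integral_cong refl)
      (simp add: indicator_def slice_emb_half_space[OF j] slice_plane_eq[OF j])
  finally show ?thesis .
qed

text \<open>The squared Bergman norm on the slice of \<open>j\<close>, pulled back to the half plane
  in the shape in which the complex lemmas take their integrals.\<close>

definition slice_energy :: "quat \<Rightarrow> (quat \<Rightarrow> quat) \<Rightarrow> ennreal" where
  "slice_energy j f = (\<integral>\<^sup>+p. ennreal (indicator {0<..} (fst p) * (norm (f (slice_emb j (Complex (fst p) (snd p)))))\<^sup>2)
    \<partial>(lborel :: (real \<times> real) measure))"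

lemma slice_regular_continuous:
  assumes "f \<in> slice_regular right_half_space"
  shows "continuous_on right_half_space f"
  using assms by (auto simp: slice_regular_half_space_iff intro: differentiable_imp_continuous_on)

lemma slice_bergman_space_iff:
  assumes j: "j \<in> imag_unit_sphere"
  shows "f \<in> slice_bergman_space right_half_space j \<longleftrightarrow>
    f \<in> slice_regular right_half_space \<and> slice_energy j f < \<infinity>"
proof -
  have "(\<integral>\<^sup>+q\<in>right_half_space \<inter> slice_plane j. ennreal ((norm (f q))\<^sup>2) \<partial>slice_measure j) = slice_energy j f"
    if f: "f \<in> slice_regular right_half_space"
  proof -
    let ?S = "right_half_space \<inter> slice_plane j"
    have "(\<integral>\<^sup>+q\<in>?S. ennreal ((norm (f q))\<^sup>2) \<partial>slice_measure j)
      = (\<integral>\<^sup>+q. ennreal ((norm (indicator ?S q *\<^sub>R f q))\<^sup>2) \<partial>slice_measure j)"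
      by (intro nn_integral_cong) (simp add: indicator_def)
    also have "\<dots> = (\<integral>\<^sup>+p. ennreal ((norm (indicator ?S (slice_emb j (Complex (fst p) (snd p)))
        *\<^sub>R f (slice_emb j (Complex (fst p) (snd p)))))\<^sup>2) \<partial>lborel)"
      unfolding slice_measure_eq
    proof (rule nn_integral_distr)
      have [measurable]: "(\<lambda>q. indicator ?S q *\<^sub>R f q) \<in> borel_measurable borel"
        by (rule slice_measurable[OF j slice_regular_continuous[OF f]])
      show "(\<lambda>q. ennreal ((norm (indicator ?S q *\<^sub>R f q))\<^sup>2))
          \<in> borel_measurable (distr lborel borel (\<lambda>p. slice_emb j (Complex (fst p) (snd p))))"
        by measurable
    qed (use borel_measurable_slice_emb in simp)
    also have "\<dots> = slice_energy j f"
      unfolding slice_energy_def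
      by (intro nn_integral_cong)
        (simp add: indicator_def slice_emb_half_space[OF j] slice_plane_eq[OF j])
    finally show ?thesis .
  qed
  then show ?thesis
    by (auto simp: slice_bergman_space_def)
qed

lemma slice_regular_measurable:
  assumes f: "f \<in> slice_regular right_half_space" and j: "j \<in> imag_unit_sphere"
  shows "(\<lambda>p. indicator {0<..} (fst p) *\<^sub>R f (slice_emb j (Complex (fst p) (snd p)))) \<in> borel_measurable borel"
proof -
  have "continuous_on {z. 0 < Re z} (\<lambda>z. f (slice_emb j z))"
    by (rule continuous_on_compose2[OF slice_regular_continuous[OF f]])
      (auto simp: slice_emb_half_space[OF j] intro: linear_continuous_on[OF bounded_linear_slice_emb])
  then show ?thesis by (rule measurable_half_plane)
qed

lemma slice_square_integrable:
  assumes f: "f \<in> slice_bergman_space right_half_space j" and j: "j \<in> imag_unit_sphere"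
  shows "integrable lborel (\<lambda>p. indicator {0<..} (fst p) * (norm (f (slice_emb j (Complex (fst p) (snd p)))))\<^sup>2)"
proof -
  have *: "indicator {0<..} (fst p) * (norm (f (slice_emb j (Complex (fst p) (snd p)))))\<^sup>2
      = (norm (indicator {0<..} (fst p) *\<^sub>R f (slice_emb j (Complex (fst p) (snd p)))))\<^sup>2" for p :: "real \<times> real"
    by (auto simp: indicator_def)
  have "f \<in> slice_regular right_half_space" "slice_energy j f < \<infinity>"
    using f by (simp_all add: slice_bergman_space_iff[OF j])
  moreover from this have "(\<lambda>p. indicator {0<..} (fst p) * (norm (f (slice_emb j (Complex (fst p) (snd p)))))\<^sup>2) \<in> borel_measurable borel"
    unfolding * using slice_regular_measurable[OF _ j] by measurable
  ultimately show ?thesis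
    unfolding slice_energy_def by (intro integrableI_nonneg) auto
qed

text \<open>As in the complex case, the product of the norms is at most the mean of their squares.
  Integrability is needed wherever the inner product is split or moved through a linear map.\<close>

lemma slice_product_integrable:
  assumes f: "f \<in> slice_bergman_space right_half_space j" and g: "g \<in> slice_bergman_space right_half_space j"
    and j: "j \<in> imag_unit_sphere"
  shows "integrable lborel (\<lambda>p. indicator {0<..} (fst p) *\<^sub>R
    (qcnj (f (slice_emb j (Complex (fst p) (snd p)))) * g (slice_emb j (Complex (fst p) (snd p)))))"
    (is "integrable _ ?h")
proof -
  let ?w = "\<lambda>p::real\<times>real. slice_emb j (Complex (fst p) (snd p))"
  let ?i = "\<lambda>p::real\<times>real. indicator {0<..} (fst p) :: real"
  have "integrable lborel (\<lambda>p. (?i p * (norm (f (?w p)))\<^sup>2 + ?i p * (norm (g (?w p)))\<^sup>2) / 2)"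
    using slice_square_integrable[OF f j] slice_square_integrable[OF g j] by auto
  then show ?thesis
  proof (rule Bochner_Integration.integrable_bound)
    have "f \<in> slice_regular right_half_space" "g \<in> slice_regular right_half_space"
      using f g by (simp_all add: slice_bergman_space_iff[OF j])
    then have [measurable]: "(\<lambda>p. ?i p *\<^sub>R f (?w p)) \<in> borel_measurable borel" "(\<lambda>p. ?i p *\<^sub>R g (?w p)) \<in> borel_measurable borel"
      using slice_regular_measurable[OF _ j] by auto
    have [measurable]: "qcnj \<in> borel_measurable borel"
      by (intro borel_measurable_continuous_onI linear_continuous_on bounded_linear_qcnj)
    have "?h = (\<lambda>p. qcnj (?i p *\<^sub>R f (?w p)) * (?i p *\<^sub>R g (?w p)))"
      by (auto simp: fun_eq_iff indicator_def)
    also have "\<dots> \<in> borel_measurable borel" by measurable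
    finally show "?h \<in> borel_measurable lborel" by simp
    show "AE p in lborel. norm (?h p) \<le> norm ((?i p * (norm (f (?w p)))\<^sup>2 + ?i p * (norm (g (?w p)))\<^sup>2) / 2)"
    proof (rule AE_I2)
      fix p :: "real \<times> real"
      have "0 \<le> (norm (f (?w p)) - norm (g (?w p)))\<^sup>2" by simp
      then have "norm (f (?w p)) * norm (g (?w p)) \<le> ((norm (f (?w p)))\<^sup>2 + (norm (g (?w p)))\<^sup>2) / 2"
        by (simp add: power2_diff)
      then show "norm (?h p) \<le> norm ((?i p * (norm (f (?w p)))\<^sup>2 + ?i p * (norm (g (?w p)))\<^sup>2) / 2)"
        by (auto simp: indicator_def norm_mult)
    qed
  qed
qed

lemma slice_inner_eq:
  assumes f: "f \<in> slice_bergman_space right_half_space j" and g: "g \<in> slice_bergman_space right_half_space j"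
    and j: "j \<in> imag_unit_sphere"
  shows "slice_inner right_half_space j f g = (LINT p|lborel. indicator {0<..} (fst p) *\<^sub>R
    (qcnj (f (slice_emb j (Complex (fst p) (snd p)))) * g (slice_emb j (Complex (fst p) (snd p)))))"
  unfolding slice_inner_def
proof (rule slice_integral_eq[OF j])
  have "f \<in> slice_regular right_half_space" "g \<in> slice_regular right_half_space"
    using f g by (simp_all add: slice_bergman_space_iff[OF j])
  then have "continuous_on right_half_space f" "continuous_on right_half_space g"
    by (simp_all add: slice_regular_continuous)
  then show "continuous_on right_half_space (\<lambda>q. qcnj (f q) * g q)"
    by (intro continuous_intros bounded_linear.continuous_on[OF bounded_linear_qcnj])
qed

text \<open>This puts every complex component of \<open>f\<close> into the Bergman space of the half
  plane, where the point estimate and the reproducing formula apply to it.\<close>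

lemma slice_component_energy:
  assumes f: "f \<in> slice_bergman_space right_half_space j" and j: "j \<in> imag_unit_sphere"
  shows "(\<integral>\<^sup>+p. ennreal (indicator {0<..} (fst p) *
      (norm (slice_proj j (f (slice_emb j (Complex (fst p) (snd p))) * c)))\<^sup>2) \<partial>(lborel :: (real \<times> real) measure))
    \<le> ennreal ((norm c)\<^sup>2) * slice_energy j f"
proof -
  let ?w = "\<lambda>p::real\<times>real. slice_emb j (Complex (fst p) (snd p))"
  have "(norm (slice_proj j (v * c)))\<^sup>2 \<le> (norm c)\<^sup>2 * (norm v)\<^sup>2" for v
    using power_mono[OF norm_slice_proj_le[OF j, of "v * c"], of 2]
    by (simp add: norm_mult power_mult_distrib mult.commute)
  then have "(\<integral>\<^sup>+p. ennreal (indicator {0<..} (fst p) * (norm (slice_proj j (f (?w p) * c)))\<^sup>2) \<partial>lborel)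
    \<le> (\<integral>\<^sup>+p. ennreal ((norm c)\<^sup>2) * ennreal (indicator {0<..} (fst p) * (norm (f (?w p)))\<^sup>2) \<partial>lborel)"
    by (intro nn_integral_mono) (auto simp: indicator_def simp flip: ennreal_mult intro!: ennreal_leI)
  also have "\<dots> = ennreal ((norm c)\<^sup>2) * slice_energy j f"
    unfolding slice_energy_def
    using slice_square_integrable[OF f j] by (intro nn_integral_cmult) auto
  finally show ?thesis .
qed

lemma differentiable_on_restrict:
  "f differentiable_on S \<Longrightarrow> restrict f S differentiable_on S"
  unfolding differentiable_on_def
  by (auto intro: differentiable_transform_within[of f _ S 1])

text \<open>The restriction is needed for membership: outside the half space the pointwise
  difference of two extensional functions is 0, whereas \<open>extensional\<close> asks for
  \<open>undefined\<close>.\<close>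

lemma slice_bergman_space_diff:
  assumes f: "f \<in> slice_bergman_space right_half_space j" and g: "g \<in> slice_bergman_space right_half_space j"
    and j: "j \<in> imag_unit_sphere"
  shows "restrict (\<lambda>q. f q - g q) right_half_space \<in> slice_bergman_space right_half_space j"
    (is "?d \<in> _")
proof -
  let ?w = "\<lambda>p::real\<times>real. slice_emb j (Complex (fst p) (snd p))"
  have fg: "f \<in> slice_regular right_half_space" "g \<in> slice_regular right_half_space"
    using f g by (simp_all add: slice_bergman_space_iff[OF j])
  have "?d \<in> slice_regular right_half_space"
    unfolding slice_regular_half_space_iff
  proof (intro conjI ballI allI impI)
    have "(\<lambda>q. f q - g q) differentiable_on right_half_space"
      using fg by (simp add: slice_regular_half_space_iff differentiable_on_diff)
    then show "?d differentiable_on right_half_space"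
      by (rule differentiable_on_restrict)
  next
    fix i z assume i: "i \<in> imag_unit_sphere" and z: "0 < Re z"
    obtain d e where
      d: "((\<lambda>z. f (slice_emb i z)) has_derivative (\<lambda>h. slice_emb i h * d)) (at z)" and
      e: "((\<lambda>z. g (slice_emb i z)) has_derivative (\<lambda>h. slice_emb i h * e)) (at z)"
      using fg i z unfolding slice_regular_half_space_iff by meson
    have "((\<lambda>z. ?d (slice_emb i z)) has_derivative (\<lambda>h. slice_emb i h * (d - e))) (at z)"
    proof (rule has_derivative_transform_within_open[where s = "{z. 0 < Re z}"])
      show "((\<lambda>z. f (slice_emb i z) - g (slice_emb i z)) has_derivative (\<lambda>h. slice_emb i h * (d - e))) (at z)"
        using has_derivative_diff[OF d e] by (simp add: right_diff_distrib)
    qed (use z in \<open>auto simp: open_halfspace_Re_gt slice_emb_half_space[OF i]\<close>)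
    then show "\<exists>d. ((\<lambda>z. ?d (slice_emb i z)) has_derivative (\<lambda>h. slice_emb i h * d)) (at z)" ..
  qed simp
  moreover have "slice_energy j ?d < \<infinity>"
  proof -
    have "slice_energy j ?d \<le> (\<integral>\<^sup>+p. ennreal (2 * (indicator {0<..} (fst p) * (norm (f (?w p)))\<^sup>2)
        + 2 * (indicator {0<..} (fst p) * (norm (g (?w p)))\<^sup>2)) \<partial>lborel)"
      unfolding slice_energy_def
    proof (intro nn_integral_mono ennreal_leI)
      fix p :: "real \<times> real"
      have "(norm (u - v))\<^sup>2 \<le> 2 * (norm u)\<^sup>2 + 2 * (norm v)\<^sup>2" for u v :: quat
      proof -
        have "(norm (u - v))\<^sup>2 \<le> (norm u + norm v)\<^sup>2"
          by (intro power_mono norm_triangle_ineq4) simp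
        also have "\<dots> \<le> 2 * (norm u)\<^sup>2 + 2 * (norm v)\<^sup>2"
          using sum_squares_bound[of "norm u" "norm v"] by (simp add: power2_sum)
        finally show ?thesis .
      qed
      then show "indicator {0<..} (fst p) * (norm (?d (?w p)))\<^sup>2
        \<le> 2 * (indicator {0<..} (fst p) * (norm (f (?w p)))\<^sup>2) + 2 * (indicator {0<..} (fst p) * (norm (g (?w p)))\<^sup>2)"
        by (auto simp: indicator_def slice_emb_half_space[OF j])
    qed
    also have "\<dots> < \<infinity>"
      using slice_square_integrable[OF f j] slice_square_integrable[OF g j]
      by (subst nn_integral_eq_integral) auto
    finally show ?thesis .
  qed
  ultimately show ?thesis
    by (simp add: slice_bergman_space_iff[OF j])
qed

text \<open>Zero energy would by itself give only vanishing almost everywhere on one slice. The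
  point estimate for all components makes it vanish at every point of that slice, and
  \<open>slice_regular_identity\<close> carries this to the remaining slices.\<close>

lemma slice_inner_self_eq_0:
  assumes f: "f \<in> slice_bergman_space right_half_space j" and j: "j \<in> imag_unit_sphere"
    and zero: "slice_inner right_half_space j f f = 0" and q: "q \<in> right_half_space"
  shows "f q = 0"
proof -
  let ?w = "\<lambda>p::real\<times>real. slice_emb j (Complex (fst p) (snd p))"
  have sr: "f \<in> slice_regular right_half_space"
    using f by (simp add: slice_bergman_space_iff[OF j])
  let ?n = "\<lambda>p. indicator {0<..} (fst p) * (norm (f (?w p)))\<^sup>2"
  have int: "integrable lborel ?n" by (rule slice_square_integrable[OF f j])
  have "slice_inner right_half_space j f f = (LINT p|lborel. ?n p *\<^sub>R 1)"
    unfolding slice_inner_eq[OF f f j] qcnj_mult_self by (simp add: scaleR_conv_of_real)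
  also have "\<dots> = (LINT p|lborel. ?n p) *\<^sub>R 1"
    using int by (intro integral_scaleR_left) auto
  finally have "(LINT p|lborel. ?n p) = 0"
    using zero by simp
  then have E: "slice_energy j f = 0"
    unfolding slice_energy_def using int by (subst nn_integral_eq_integral) auto
  have "f (slice_emb j z) = 0" if z: "0 < Re z" for z
  proof (rule slice_proj_mult_eqI)
    fix c
    have "ennreal (pi * (Re z / 2)\<^sup>2 * (norm (slice_proj j (f (slice_emb j z) * c)))\<^sup>2) \<le> 4 * (ennreal ((norm c)\<^sup>2) * slice_energy j f)"
      using z by (intro order_trans[OF bergman_point_estimate[OF slice_regular_holomorphic[OF sr j]]]
        mult_left_mono slice_component_energy[OF f j]) auto
    then show "slice_proj j (f (slice_emb j z) * c) = slice_proj j (0 * c)"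
      using z pi_gt_zero by (simp add: E ennreal_eq_0_iff mult_le_0_iff linorder_not_le[THEN iffD2] linear_simps[OF bounded_linear_slice_proj])
  qed
  then show ?thesis
    using slice_regular_identity[OF sr j _ q] by blast
qed

section \<open>The slice Bergman kernels\<close>

text \<open>
  On the slice of \<open>q\<close> the formula below reduces to \<open>\<pi>\<^sup>-\<^sup>1 (w + cnj q)\<^sup>-\<^sup>2\<close>: the factor \<open>(w + q)\<^sup>2\<close> of the
  numerator cancels against the denominator, which has real coefficients and therefore makes sense on all slices.
\<close>

definition half_space_kernel :: "quat \<Rightarrow> quat \<Rightarrow> quat" where
  "half_space_kernel q = restrict (\<lambda>w. (1 / pi) *\<^sub>R
     ((inverse (w\<^sup>2 + 2 * of_real (qRe q) * w + of_real ((norm q)\<^sup>2)))\<^sup>2 * (w\<^sup>2 + 2 * w * q + q\<^sup>2)))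
     right_half_space"

section \<open>The representing function of a slice\<close>

lemma half_plane_add_nonzero:
  assumes "0 < Re z" "0 < Re w"
  shows "z + w \<noteq> 0" "z + cnj w \<noteq> 0"
  using assms by (auto simp: complex_eq_iff)

text \<open>The polynomial with the roots - w and - \<open>cnj w\<close> has the real coefficients 2
  Re w and |w|^2. They are central and do not depend on \<open>j\<close>, so the whole expression
  stays on the slice of \<open>i\<close>.\<close>

lemma slice_emb_quadratic:
  assumes i: "i \<in> imag_unit_sphere" and j: "j \<in> imag_unit_sphere"
  shows "(slice_emb i z)\<^sup>2 + 2 * of_real (qRe (slice_emb j w)) * slice_emb i z + of_real ((norm (slice_emb j w))\<^sup>2)
    = slice_emb i ((z + w) * (z + cnj w))"
proof -
  have "(z + w) * (z + cnj w) = z\<^sup>2 + of_real (2 * Re w) * z + of_real ((norm w)\<^sup>2)"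
    using complex_add_cnj[of w] complex_norm_square[of w]
    by (simp add: algebra_simps power2_eq_square) (metis distrib_left mult.commute)
  then show ?thesis
    by (simp add: slice_emb_mult[OF i] slice_emb_power[OF i] qRe_slice_emb[OF j] norm_slice_emb[OF j])
qed

text \<open>Sorting by powers of the parameter displays the kernel as a sum of holomorphic functions
  on the slice of \<open>i\<close> with quaternionic constants on the right, the shape for which
  slice regularity can be read off on every slice.\<close>

lemma half_space_kernel_slice_emb:
  fixes z w :: complex
  assumes i: "i \<in> imag_unit_sphere" and j: "j \<in> imag_unit_sphere" and z: "0 < Re z"
  defines "E \<equiv> (z + w) * (z + cnj w)"
  shows "half_space_kernel (slice_emb j w) (slice_emb i z) = (1 / pi) *\<^sub>R
    (slice_emb i (z\<^sup>2 / E\<^sup>2) + slice_emb i (2 * z / E\<^sup>2) * slice_emb j w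
      + slice_emb i (1 / E\<^sup>2) * (slice_emb j w)\<^sup>2)"
proof -
  have in_H: "slice_emb i z \<in> right_half_space" using z by (simp add: slice_emb_half_space[OF i])
  have "slice_emb i (u / E\<^sup>2) = (inverse (slice_emb i E))\<^sup>2 * slice_emb i u" for u
    by (simp add: divide_inverse mult.commute[of u] power_inverse
        flip: slice_emb_mult[OF i] slice_emb_inverse[OF i] slice_emb_power[OF i])
  moreover have "half_space_kernel (slice_emb j w) (slice_emb i z) = (1 / pi) *\<^sub>R ((inverse (slice_emb i E))\<^sup>2
      * ((slice_emb i z)\<^sup>2 + 2 * slice_emb i z * slice_emb j w + (slice_emb j w)\<^sup>2))"
    using in_H by (simp only: half_space_kernel_def restrict_apply if_True slice_emb_quadratic[OF i j] E_def)
  ultimately show ?thesis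
    by (simp add: distrib_left mult.assoc slice_emb_mult[OF i] slice_emb_power[OF i])
qed

lemma half_space_kernel_same_slice:
  assumes j: "j \<in> imag_unit_sphere" and z: "0 < Re z" and w: "0 < Re w"
  shows "half_space_kernel (slice_emb j w) (slice_emb j z) = slice_emb j (1 / (pi * (z + cnj w)\<^sup>2))"
proof -
  define E where "E = (z + w) * (z + cnj w)"
  have "half_space_kernel (slice_emb j w) (slice_emb j z)
    = (1 / pi) *\<^sub>R slice_emb j (z\<^sup>2 / E\<^sup>2 + 2 * z / E\<^sup>2 * w + 1 / E\<^sup>2 * w\<^sup>2)"
    unfolding half_space_kernel_slice_emb[OF j j z] E_def[symmetric]
    by (simp only: slice_emb_linear_simps(1) slice_emb_mult[OF j, of _ w] slice_emb_mult[OF j, of _ "w\<^sup>2"] slice_emb_power[OF j, of w])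
  also have "z\<^sup>2 / E\<^sup>2 + 2 * z / E\<^sup>2 * w + 1 / E\<^sup>2 * w\<^sup>2 = (z + w)\<^sup>2 / E\<^sup>2"
    by (simp add: power2_sum add_divide_distrib)
  also have "\<dots> = 1 / (z + cnj w)\<^sup>2"
    using half_plane_add_nonzero[OF z w] by (simp add: E_def power_mult_distrib)
  finally show ?thesis
    by (simp add: scaleR_conv_of_real flip: slice_emb_of_real[of j] slice_emb_mult[OF j])
qed

lemma slice_emb_holomorphic_has_derivative:
  assumes i: "i \<in> imag_unit_sphere" and h: "(h has_field_derivative d) (at z)"
  shows "((\<lambda>z. slice_emb i (h z) * c) has_derivative (\<lambda>v. slice_emb i v * (slice_emb i d * c))) (at z)"
proof -
  have "bounded_linear (\<lambda>v. slice_emb i v * c)"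
    by (rule bounded_linear_compose[OF bounded_linear_mult_left bounded_linear_slice_emb])
  moreover have "(h has_derivative (\<lambda>v. d * v)) (at z)"
    using h by (simp add: has_field_derivative_def)
  ultimately have "((\<lambda>z. slice_emb i (h z) * c) has_derivative (\<lambda>v. slice_emb i (d * v) * c)) (at z)"
    by (rule bounded_linear.has_derivative)
  then show ?thesis
    by (simp add: mult.commute[of d] slice_emb_mult[OF i] mult.assoc)
qed

lemma half_space_kernel_in_bergman_space:
  assumes j: "j \<in> imag_unit_sphere" and w: "0 < Re w"
  shows "half_space_kernel (slice_emb j w) \<in> slice_bergman_space right_half_space j"
  unfolding slice_bergman_space_iff[OF j]
proof
  let ?q = "slice_emb j w"
  let ?K = "half_space_kernel ?q"
  let ?E = "\<lambda>v. v\<^sup>2 + 2 * of_real (qRe ?q) * v + of_real ((norm ?q)\<^sup>2)"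
  let ?P = "\<lambda>v. v\<^sup>2 + 2 * v * ?q + ?q\<^sup>2"
  let ?e = "\<lambda>z. (z + w) * (z + cnj w)"
  show "?K \<in> slice_regular right_half_space"
    unfolding slice_regular_half_space_iff
  proof (intro conjI ballI allI impI)
    show "?K \<in> extensional right_half_space"
      by (simp add: half_space_kernel_def)
    have "(\<lambda>v. (1 / pi) *\<^sub>R ((inverse (?E v))\<^sup>2 * ?P v)) differentiable at v" if v: "v \<in> right_half_space" for v
    proof -
      \<comment> \<open>Real differentiability in all four coordinates is a separate requirement and
        needs a nonzero denominator. On the slice of \<open>v\<close> itself the denominator factors
        as \<open>(z + w) * (z + cnj w)\<close>, and both factors have positive real part.\<close>
      obtain i z where i: "i \<in> imag_unit_sphere" and vz: "v = slice_emb i z"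
        by (rule exists_slice_emb)
      have "0 < Re z" using v by (simp add: vz slice_emb_half_space[OF i])
      then have "?e z \<noteq> 0" using w half_plane_add_nonzero by simp
      then have "norm (slice_emb i (?e z)) \<noteq> 0" by (simp only: norm_slice_emb[OF i] norm_eq_zero not_False_eq_True)
      then have ne: "?E v \<noteq> 0"
        unfolding vz slice_emb_quadratic[OF i j] by auto
      have "?E differentiable at v" "?P differentiable at v"
        by (auto simp: power2_eq_square intro!: derivative_intros)
      then have "\<exists>D. (?E has_derivative D) (at v)" "\<exists>D. (?P has_derivative D) (at v)"
        by (simp_all only: differentiable_def)
      then obtain E' P' where E': "(?E has_derivative E') (at v)" and P': "(?P has_derivative P') (at v)"
        by (elim exE)
      note inv = Deriv.has_derivative_inverse[OF ne E']
      show ?thesis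
        unfolding differentiable_def power2_eq_square[of "inverse _"]
        by (intro exI) (rule has_derivative_scaleR_right[OF has_derivative_mult[OF has_derivative_mult[OF inv inv] P']])
    qed
    then have "(\<lambda>v. (1 / pi) *\<^sub>R ((inverse (?E v))\<^sup>2 * ?P v)) differentiable_on right_half_space"
      by (simp add: differentiable_on_eq_differentiable_at[OF open_right_half_space])
    then show "?K differentiable_on right_half_space"
      unfolding half_space_kernel_def by (rule differentiable_on_restrict)
  next
    fix i z assume i: "i \<in> imag_unit_sphere" and z: "0 < Re z"
    have ne: "?e z \<noteq> 0" if "0 < Re z" for z
      using that w half_plane_add_nonzero by simp
    have "\<exists>d. ((\<lambda>z. h z / (?e z)\<^sup>2) has_field_derivative d) (at z)" if "h holomorphic_on {z. 0 < Re z}" for h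
    proof -
      have "(\<lambda>z. h z / (?e z)\<^sup>2) holomorphic_on {z. 0 < Re z}"
        using ne by (intro holomorphic_intros that) auto
      then show ?thesis
        using z by (auto simp: holomorphic_on_open open_halfspace_Re_gt)
    qed
    then have "\<exists>d. ((\<lambda>z. z\<^sup>2 / (?e z)\<^sup>2) has_field_derivative d) (at z)"
      "\<exists>d. ((\<lambda>z. 2 * z / (?e z)\<^sup>2) has_field_derivative d) (at z)"
      "\<exists>d. ((\<lambda>z. 1 / (?e z)\<^sup>2) has_field_derivative d) (at z)"
      by (simp_all only: holomorphic_intros)
    then obtain a b c where
      "((\<lambda>z. z\<^sup>2 / (?e z)\<^sup>2) has_field_derivative a) (at z)"
      "((\<lambda>z. 2 * z / (?e z)\<^sup>2) has_field_derivative b) (at z)"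
      "((\<lambda>z. 1 / (?e z)\<^sup>2) has_field_derivative c) (at z)"
      by (elim exE)
    from this[THEN slice_emb_holomorphic_has_derivative[OF i]]
    have "((\<lambda>z. (1 / pi) *\<^sub>R (slice_emb i (z\<^sup>2 / (?e z)\<^sup>2) * 1 + slice_emb i (2 * z / (?e z)\<^sup>2) * ?q
        + slice_emb i (1 / (?e z)\<^sup>2) * ?q\<^sup>2)) has_derivative
      (\<lambda>v. (1 / pi) *\<^sub>R (slice_emb i v * (slice_emb i a * 1) + slice_emb i v * (slice_emb i b * ?q)
        + slice_emb i v * (slice_emb i c * ?q\<^sup>2)))) (at z)"
      by (intro has_derivative_scaleR_right has_derivative_add)
    then have "((\<lambda>z. ?K (slice_emb i z)) has_derivative
      (\<lambda>v. (1 / pi) *\<^sub>R (slice_emb i v * (slice_emb i a * 1) + slice_emb i v * (slice_emb i b * ?q)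
        + slice_emb i v * (slice_emb i c * ?q\<^sup>2)))) (at z)"
      by (rule has_derivative_transform_within_open[where s = "{z. 0 < Re z}"])
        (use z in \<open>auto simp only: open_halfspace_Re_gt half_space_kernel_slice_emb[OF i j] mem_Collect_eq mult_1_right\<close>)
    also have "(\<lambda>v. (1 / pi) *\<^sub>R (slice_emb i v * (slice_emb i a * 1) + slice_emb i v * (slice_emb i b * ?q)
        + slice_emb i v * (slice_emb i c * ?q\<^sup>2)))
      = (\<lambda>v. slice_emb i v * ((1 / pi) *\<^sub>R (slice_emb i a + slice_emb i b * ?q + slice_emb i c * ?q\<^sup>2)))"
      by (simp add: algebra_simps)
    finally show "\<exists>d. ((\<lambda>z. ?K (slice_emb i z)) has_derivative (\<lambda>v. slice_emb i v * d)) (at z)" ..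
  qed
  have "ennreal (indicator {0<..} (fst p) * (norm (?K (slice_emb j (Complex (fst p) (snd p)))))\<^sup>2)
    = ennreal ((1 / pi)\<^sup>2) * ennreal (indicator {0<..} (fst p) * (norm (1 / (w + cnj (Complex (fst p) (snd p)))\<^sup>2))\<^sup>2)"
    for p :: "real \<times> real"
  proof (cases "0 < fst p")
    case True
    let ?z = "Complex (fst p) (snd p)"
    have "norm (?z + cnj w) = norm (cnj (w + cnj ?z))" by (simp add: add.commute)
    then have "norm (?z + cnj w) = norm (w + cnj ?z)" by (simp only: complex_mod_cnj)
    then show ?thesis
      using True w unfolding ennreal_mult[symmetric, OF zero_le_power2 mult_nonneg_nonneg[OF indicator_pos_le zero_le_power2]]
      by (simp add: half_space_kernel_same_slice[OF j] norm_slice_emb[OF j] norm_divide norm_mult norm_power power_divide power_mult_distrib)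
  qed simp
  moreover have "(\<lambda>p. ennreal (indicator {0<..} (fst p) * (norm (1 / (w + cnj (Complex (fst p) (snd p)))\<^sup>2))\<^sup>2))
    \<in> borel_measurable (borel :: (real \<times> real) measure)"
  proof -
    have *: "indicator {0<..} (fst p) * (norm (1 / (w + cnj (Complex (fst p) (snd p)))\<^sup>2))\<^sup>2
      = (norm (indicator {0<..} (fst p) *\<^sub>R (1 / (w + cnj (Complex (fst p) (snd p)))\<^sup>2)))\<^sup>2" for p :: "real \<times> real"
      by (auto simp: indicator_def)
    have "continuous_on {z. 0 < Re z} (\<lambda>z. 1 / (w + cnj z)\<^sup>2)"
      using half_plane_add_nonzero[OF w] by (intro continuous_intros) auto
    from measurable_half_plane[OF this] show ?thesis
      unfolding * by measurable
  qed
  ultimately show "slice_energy j ?K < \<infinity>"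
    using half_plane_kernel_square_integrable[OF w]
    by (simp add: slice_energy_def nn_integral_cmult ennreal_mult_less_top)
qed

text \<open>Each component v -> \<open>slice_proj j (v * c)\<close> is bounded and linear, so it
  passes through the integral. The conjugated kernel takes values in the slice and stands on the
  left, so it comes out of the projection as a complex factor, and the complex formula
  remains.\<close>

lemma half_space_kernel_reproducing:
  assumes j: "j \<in> imag_unit_sphere" and w: "0 < Re w"
    and f: "f \<in> slice_bergman_space right_half_space j"
  shows "slice_inner right_half_space j (half_space_kernel (slice_emb j w)) f = f (slice_emb j w)"
proof (rule slice_proj_mult_eqI)
  fix c
  let ?K = "half_space_kernel (slice_emb j w)"
  let ?z = "\<lambda>p::real\<times>real. Complex (fst p) (snd p)"
  let ?F = "\<lambda>z. slice_proj j (f (slice_emb j z) * c)"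
  let ?h = "\<lambda>p. indicator {0<..} (fst p) *\<^sub>R (qcnj (?K (slice_emb j (?z p))) * f (slice_emb j (?z p)))"
  have sr: "f \<in> slice_regular right_half_space" and fin: "slice_energy j f < \<infinity>"
    using f by (simp_all add: slice_bergman_space_iff[OF j])
  have hol: "?F holomorphic_on {z. 0 < Re z}"
    by (rule slice_regular_holomorphic[OF sr j])
  have K: "?K \<in> slice_bergman_space right_half_space j"
    by (rule half_space_kernel_in_bergman_space[OF j w])
  have lin: "bounded_linear (\<lambda>v. slice_proj j (v * c))"
    by (rule bounded_linear_compose[OF bounded_linear_slice_proj bounded_linear_mult_left])
  have int: "integrable lborel ?h" by (rule slice_product_integrable[OF K f j])
  have "slice_proj j (slice_inner right_half_space j ?K f * c) = (LINT p|lborel. slice_proj j (?h p * c))"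
    unfolding slice_inner_eq[OF K f j] by (rule integral_bounded_linear[OF lin int, symmetric])
  also have "\<dots> = (LINT p|lborel. (1 / pi) *\<^sub>R (indicator {0<..} (fst p) *\<^sub>R (?F (?z p) / (w + cnj (?z p))\<^sup>2)))"
  proof (intro Bochner_Integration.integral_cong refl)
    fix p :: "real \<times> real"
    show "slice_proj j (?h p * c) = (1 / pi) *\<^sub>R (indicator {0<..} (fst p) *\<^sub>R (?F (?z p) / (w + cnj (?z p))\<^sup>2))"
    proof (cases "0 < fst p")
      case True
      have "cnj (1 / (pi * (?z p + cnj w)\<^sup>2)) = 1 / (pi * (w + cnj (?z p))\<^sup>2)"
        by (simp add: add.commute)
      then have "qcnj (?K (slice_emb j (?z p))) = slice_emb j (1 / (pi * (w + cnj (?z p))\<^sup>2))"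
        using True w by (simp add: half_space_kernel_same_slice[OF j] flip: slice_emb_cnj[OF j])
      then show ?thesis
        using True by (simp add: mult.assoc slice_proj_mult[OF j] scaleR_conv_of_real)
    qed (simp add: linear_simps[OF bounded_linear_slice_proj])
  qed
  also have "\<dots> = (1 / pi) *\<^sub>R (pi * ?F w)"
    unfolding integral_scaleR_right
  proof (subst half_plane_bergman_reproducing[OF hol _ w])
    show "(\<integral>\<^sup>+p. ennreal (indicator {0<..} (fst p) * (norm (?F (?z p)))\<^sup>2) \<partial>(lborel :: (real \<times> real) measure)) < \<infinity>"
      by (rule le_less_trans[OF slice_component_energy[OF f j]]) (use fin in \<open>simp add: ennreal_mult_less_top\<close>)
  qed simp
  also have "\<dots> = slice_proj j (f (slice_emb j w) * c)"
    by (simp add: scaleR_conv_of_real)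
  finally show "slice_proj j (slice_inner right_half_space j ?K f * c) = slice_proj j (f (slice_emb j w) * c)" .
qed

lemma slice_inner_diff_left:
  assumes f: "f \<in> slice_bergman_space right_half_space j" and g: "g \<in> slice_bergman_space right_half_space j"
    and h: "h \<in> slice_bergman_space right_half_space j" and j: "j \<in> imag_unit_sphere"
  shows "slice_inner right_half_space j (restrict (\<lambda>q. f q - g q) right_half_space) h
    = slice_inner right_half_space j f h - slice_inner right_half_space j g h"
  unfolding slice_inner_eq[OF slice_bergman_space_diff[OF f g j] h j] slice_inner_eq[OF f h j] slice_inner_eq[OF g h j]
  by (subst Bochner_Integration.integral_diff[symmetric, OF slice_product_integrable[OF f h j] slice_product_integrable[OF g h j]])
    (auto intro!: Bochner_Integration.integral_cong
      simp: indicator_def slice_emb_half_space[OF j] qcnj_diff left_diff_distrib)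

lemma slice_bergman_rep_half_space:
  assumes j: "j \<in> imag_unit_sphere" and w: "0 < Re w"
  shows "slice_bergman_rep right_half_space j (slice_emb j w) = half_space_kernel (slice_emb j w)"
  unfolding slice_bergman_rep_def
proof (rule the_equality)
  let ?q = "slice_emb j w"
  let ?A = "slice_bergman_space right_half_space j"
  have K0: "half_space_kernel ?q \<in> ?A"
    by (rule half_space_kernel_in_bergman_space[OF j w])
  then show "half_space_kernel ?q \<in> ?A \<and> (\<forall>f\<in>?A. f ?q = slice_inner right_half_space j (half_space_kernel ?q) f)"
    using half_space_kernel_reproducing[OF j w] by simp
  fix K assume K: "K \<in> ?A \<and> (\<forall>f\<in>?A. f ?q = slice_inner right_half_space j K f)"
  let ?d = "restrict (\<lambda>v. K v - half_space_kernel ?q v) right_half_space"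
  have d: "?d \<in> ?A" using K K0 by (simp add: slice_bergman_space_diff[OF _ _ j])
  \<comment> \<open>Both reproducing properties are tested on the difference itself: the inner
    product equals d(q) - d(q).\<close>
  have "slice_inner right_half_space j ?d ?d = 0"
    using K d half_space_kernel_reproducing[OF j w d]
    by (simp add: slice_inner_diff_left[OF _ K0 d j])
  then have "K v = half_space_kernel ?q v" if "v \<in> right_half_space" for v
    using slice_inner_self_eq_0[OF d j _ that] that by simp
  \<comment> \<open>Agreement on the half space gives equality of total functions only because both
    are \<open>undefined\<close> elsewhere.\<close>
  moreover have "K \<in> extensional right_half_space" "half_space_kernel ?q \<in> extensional right_half_space"
    using K K0 by (auto simp: slice_bergman_space_def slice_regular_def)
  ultimately show "K = half_space_kernel ?q"
    by (intro extensionalityI) auto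
qed

lemma slice_bergman_kernel_half_space:
  assumes j: "j \<in> imag_unit_sphere" and z: "0 < Re z" and w: "0 < Re w"
  shows "slice_bergman_kernel right_half_space j (slice_emb j z) (slice_emb j w)
    = slice_emb j (1 / (pi * (z + cnj w)\<^sup>2))"
proof -
  have "cnj (1 / (pi * (w + cnj z)\<^sup>2)) = 1 / (pi * (z + cnj w)\<^sup>2)"
    by (simp add: add.commute)
  then show ?thesis
    by (simp add: slice_bergman_kernel_def slice_bergman_rep_half_space[OF j z]
        half_space_kernel_same_slice[OF j w z] flip: slice_emb_cnj[OF j])
qed

section \<open>Extension of the kernel to the other slices\<close>

lemma slice_extension:
  assumes i: "i \<in> imag_unit_sphere" and j: "j \<in> imag_unit_sphere"
  shows "(1 / 2) *\<^sub>R ((1 - i * j) * slice_emb j (u * v)) + (1 / 2) *\<^sub>R ((1 + i * j) * slice_emb j (cnj u * v))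
    = slice_emb i u * slice_emb j v"
proof -
  \<comment> \<open>For u = x + y j the terms in j and in i j cancel between the two summands, and
    since j squares to -1 each summand contributes x + y i. The factor \<open>v\<close> stays on the
    right and is carried along.\<close>
  have "(1 - i * j) * slice_emb j u + (1 + i * j) * slice_emb j (cnj u) = slice_emb i u + slice_emb i u"
    by (simp add: slice_emb_scaleR algebra_simps imag_unit_sphere_simps(3)[OF j])
  then have "(1 / 2) *\<^sub>R ((1 - i * j) * slice_emb j u) + (1 / 2) *\<^sub>R ((1 + i * j) * slice_emb j (cnj u)) = slice_emb i u"
    by (simp only: scaleR_add_right[symmetric] scaleR_half_double)
  then have "((1 / 2) *\<^sub>R ((1 - i * j) * slice_emb j u) + (1 / 2) *\<^sub>R ((1 + i * j) * slice_emb j (cnj u))) * slice_emb j v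
    = slice_emb i u * slice_emb j v" by simp
  then show ?thesis
    by (simp add: distrib_right slice_emb_mult[OF j] mult.assoc)
qed

lemma powi_minus_two: "x powi (-2) = (inverse x)\<^sup>2" for x :: quat
  by (simp add: power_int_def)

text \<open>The extension acts as a formal operator \<open>?T\<close> on the pair of values at z and
  at \<open>cnj z\<close>. It is additive and maps a product u(z) v(w) to
  \<open>slice_emb i u * slice_emb j v\<close>, so each way of writing the complex kernel as a sum
  of such products yields a closed form.\<close>

lemma slice_kernel_extension:
  fixes z w :: complex
  assumes i: "i \<in> imag_unit_sphere" and j: "j \<in> imag_unit_sphere" and z: "0 < Re z" and w: "0 < Re w"
  defines "q \<equiv> slice_emb i z" and "r \<equiv> slice_emb j w"
  defines "k \<equiv> (1 / 2) *\<^sub>R ((1 - i * j) * slice_emb j (1 / (pi * (z + cnj w)\<^sup>2)))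
          + (1 / 2) *\<^sub>R ((1 + i * j) * slice_emb j (1 / (pi * (cnj z + cnj w)\<^sup>2)))"
  shows "k = (1 / pi) *\<^sub>R (((qcnj q)\<^sup>2 + 2 * qcnj q * qcnj r + (qcnj r)\<^sup>2)
             * (of_real ((norm q)\<^sup>2) + 2 * of_real (qRe q) * qcnj r + (qcnj r)\<^sup>2) powi (-2))"
    and "k = (1 / pi) *\<^sub>R ((q\<^sup>2 + 2 * of_real (qRe r) * q + of_real ((norm r)\<^sup>2)) powi (-2)
             * (q\<^sup>2 + 2 * q * r + r\<^sup>2))"
proof -
  have z': "0 < Re (cnj z)" using z by simp
  let ?T = "\<lambda>u u'. (1 / 2) *\<^sub>R ((1 - i * j) * slice_emb j u) + (1 / 2) *\<^sub>R ((1 + i * j) * slice_emb j u')"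
  have T_add: "?T (a + b) (a' + b') = ?T a a' + ?T b b'" for a b a' b'
    by (simp add: distrib_left scaleR_right_distrib)
  have T: "?T (u * v) (cnj u * v) = slice_emb i u * slice_emb j v" for u v
    by (rule slice_extension[OF i j])
  have kT: "k = ?T (1 / (pi * (z + cnj w)\<^sup>2)) (1 / (pi * (cnj z + cnj w)\<^sup>2))"
    by (simp only: k_def)
  have cnj: "qcnj q = slice_emb i (cnj z)" "qcnj r = slice_emb j (cnj w)"
    by (simp_all add: q_def r_def slice_emb_cnj[OF i] slice_emb_cnj[OF j])
  \<comment> \<open>First enlargement, by the square of \<open>cnj z + cnj w\<close>.
    \<open>D\<close> is a polynomial in \<open>cnj w\<close> with the coefficients 2 Re z and |z|^2,
    which do not change when z is conjugated. So \<open>s\<close> can go into the right-hand factor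
    with the same value at both points, and the inverse ends up on the right.\<close>
  define D where "D = (cnj w + z) * (cnj w + cnj z)"
  define s where "s = 1 / (pi * D\<^sup>2)"
  have ne: "z + cnj w \<noteq> 0" "cnj z + cnj w \<noteq> 0"
    using half_plane_add_nonzero[OF z w] half_plane_add_nonzero[OF z' w] by auto
  \<comment> \<open>The explicit factor 1 makes the last term fit the pattern u * v of
    \<open>T\<close>, with u = 1.\<close>
  have "1 / (pi * (z + cnj w)\<^sup>2) = (cnj z)\<^sup>2 * s + ((2 * cnj z) * (cnj w * s) + 1 * ((cnj w)\<^sup>2 * s))"
  proof -
    have "1 / (pi * (z + cnj w)\<^sup>2) = (cnj z + cnj w)\<^sup>2 * s"
      using ne by (simp add: s_def D_def power_mult_distrib add.commute)
    then show ?thesis by (simp add: power2_sum algebra_simps)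
  qed
  moreover have "1 / (pi * (cnj z + cnj w)\<^sup>2) = cnj ((cnj z)\<^sup>2) * s + (cnj (2 * cnj z) * (cnj w * s) + cnj 1 * ((cnj w)\<^sup>2 * s))"
  proof -
    have "1 / (pi * (cnj z + cnj w)\<^sup>2) = (z + cnj w)\<^sup>2 * s"
      using ne by (simp add: s_def D_def power_mult_distrib add.commute)
    then show ?thesis by (simp add: power2_sum algebra_simps)
  qed
  ultimately have "k = slice_emb i ((cnj z)\<^sup>2) * slice_emb j s + (slice_emb i (2 * cnj z) * slice_emb j (cnj w * s)
      + slice_emb i 1 * slice_emb j ((cnj w)\<^sup>2 * s))"
    unfolding kT by (simp only: T_add T)
  also have "\<dots> = ((qcnj q)\<^sup>2 + 2 * qcnj q * qcnj r + (qcnj r)\<^sup>2) * slice_emb j s"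
    by (simp add: cnj slice_emb_mult[OF i] slice_emb_mult[OF j] slice_emb_power[OF i] slice_emb_power[OF j]
        distrib_right mult.assoc add.assoc)
  also have "slice_emb j s = (1 / pi) *\<^sub>R (slice_emb j D) powi (-2)"
  proof -
    have "s = of_real (1 / pi) * (inverse D)\<^sup>2"
      by (simp add: s_def field_simps)
    then show ?thesis
      unfolding powi_minus_two
      by (simp only: slice_emb_mult[OF j] slice_emb_power[OF j] slice_emb_inverse[OF j] slice_emb_of_real scaleR_conv_of_real)
  qed
  also have "slice_emb j D = of_real ((norm q)\<^sup>2) + 2 * of_real (qRe q) * qcnj r + (qcnj r)\<^sup>2"
    using slice_emb_quadratic[OF j i, of "cnj w" z] by (simp add: D_def q_def cnj add_ac)
  finally show "k = (1 / pi) *\<^sub>R (((qcnj q)\<^sup>2 + 2 * qcnj q * qcnj r + (qcnj r)\<^sup>2)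
             * (of_real ((norm q)\<^sup>2) + 2 * of_real (qRe q) * qcnj r + (qcnj r)\<^sup>2) powi (-2))"
    by simp
  \<comment> \<open>Second enlargement, by the square of \<open>z + w\<close>. \<open>e\<close> is a
    polynomial in z whose real coefficients come from w, so it belongs to the left-hand factor and
    the inverse ends up on the left.\<close>
  define e where "e = (z + w) * (z + cnj w)"
  define t where "t = 1 / (pi * e\<^sup>2)"
  have ne': "z + w \<noteq> 0" "cnj z + w \<noteq> 0"
    using half_plane_add_nonzero[OF z w] half_plane_add_nonzero[OF z' w] by auto
  \<comment> \<open>Conjugating z replaces \<open>e\<close> by its conjugate, since its coefficients
    are real. Hence \<open>t\<close> becomes \<open>cnj t\<close> at the second point, as
    \<open>T\<close> demands of a left-hand factor.\<close>
  have ct: "cnj t = 1 / (pi * ((cnj z + w) * (cnj z + cnj w))\<^sup>2)"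
    by (simp add: t_def e_def mult.commute)
  have "1 / (pi * (z + cnj w)\<^sup>2) = (t * z\<^sup>2) * 1 + ((2 * (t * z)) * w + t * w\<^sup>2)"
  proof -
    have "1 / (pi * (z + cnj w)\<^sup>2) = t * (z + w)\<^sup>2"
      using ne ne' by (simp add: t_def e_def power_mult_distrib)
    then show ?thesis by (simp add: power2_sum algebra_simps)
  qed
  moreover have "1 / (pi * (cnj z + cnj w)\<^sup>2) = cnj (t * z\<^sup>2) * 1 + (cnj (2 * (t * z)) * w + cnj t * w\<^sup>2)"
  proof -
    have "1 / (pi * (cnj z + cnj w)\<^sup>2) = cnj t * (cnj z + w)\<^sup>2"
      using ne ne' unfolding ct by (simp add: power_mult_distrib)
    then show ?thesis by (simp add: power2_sum algebra_simps)
  qed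
  ultimately have "k = slice_emb i (t * z\<^sup>2) * slice_emb j 1 + (slice_emb i (2 * (t * z)) * slice_emb j w
      + slice_emb i t * slice_emb j (w\<^sup>2))"
    unfolding kT by (simp only: T_add T)
  also have "\<dots> = slice_emb i t * (q\<^sup>2 + 2 * q * r + r\<^sup>2)"
  proof -
    have "2 * (t * z) = t * (2 * z)" by simp
    then have "slice_emb i (2 * (t * z)) = slice_emb i t * (2 * q)"
      by (simp only: slice_emb_mult[OF i] slice_emb_numeral q_def)
    then show ?thesis
      by (simp add: q_def r_def slice_emb_mult[OF i] slice_emb_mult[OF j] slice_emb_power[OF i] slice_emb_power[OF j]
          distrib_left mult.assoc add.assoc)
  qed
  also have "slice_emb i t = (1 / pi) *\<^sub>R (slice_emb i e) powi (-2)"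
  proof -
    have "t = of_real (1 / pi) * (inverse e)\<^sup>2"
      by (simp add: t_def field_simps)
    then show ?thesis
      unfolding powi_minus_two
      by (simp only: slice_emb_mult[OF i] slice_emb_power[OF i] slice_emb_inverse[OF i] slice_emb_of_real scaleR_conv_of_real)
  qed
  also have "slice_emb i e = q\<^sup>2 + 2 * of_real (qRe r) * q + of_real ((norm r)\<^sup>2)"
    unfolding e_def q_def r_def by (rule slice_emb_quadratic[OF i j, symmetric])
  finally show "k = (1 / pi) *\<^sub>R ((q\<^sup>2 + 2 * of_real (qRe r) * q + of_real ((norm r)\<^sup>2)) powi (-2)
             * (q\<^sup>2 + 2 * q * r + r\<^sup>2))"
    by simp
qed

theorem theorem4p4:
  fixes q r :: quat
  assumes "q \<in> right_half_space" and "r \<in> right_half_space"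
  shows "slice_bergman_kernel2 right_half_space q r =
           (1 / pi) *\<^sub>R (((qcnj q)\<^sup>2 + 2 * qcnj q * qcnj r + (qcnj r)\<^sup>2)
             * (of_real ((norm q)\<^sup>2) + 2 * of_real (qRe q) * qcnj r + (qcnj r)\<^sup>2) powi (-2))
       \<and> slice_bergman_kernel2 right_half_space q r =
           (1 / pi) *\<^sub>R ((q\<^sup>2 + 2 * of_real (qRe r) * q + of_real ((norm r)\<^sup>2)) powi (-2)
             * (q\<^sup>2 + 2 * q * r + r\<^sup>2))"
proof -
  let ?L = "(1 / pi) *\<^sub>R (((qcnj q)\<^sup>2 + 2 * qcnj q * qcnj r + (qcnj r)\<^sup>2)
             * (of_real ((norm q)\<^sup>2) + 2 * of_real (qRe q) * qcnj r + (qcnj r)\<^sup>2) powi (-2))"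
  let ?R = "(1 / pi) *\<^sub>R ((q\<^sup>2 + 2 * of_real (qRe r) * q + of_real ((norm r)\<^sup>2)) powi (-2)
             * (q\<^sup>2 + 2 * q * r + r\<^sup>2))"
  let ?k = "\<lambda>i j x y. (1 / 2) *\<^sub>R ((1 - i * j) * slice_bergman_kernel right_half_space j (slice_point j x y) r)
          + (1 / 2) *\<^sub>R ((1 + i * j) * slice_bergman_kernel right_half_space j (slice_point j x (- y)) r)"
  \<comment> \<open>The closed forms mention only \<open>q\<close> and \<open>r\<close>, so proving
    them for every admissible choice of \<open>i\<close>, \<open>j\<close>, \<open>x\<close>,
    \<open>y\<close> also settles independence of the choice, including real \<open>q\<close> or
    \<open>r\<close>, where every unit is admissible.\<close>
  have k: "?k i j x y = ?L" "?k i j x y = ?R"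
    if i: "i \<in> imag_unit_sphere" and j: "j \<in> imag_unit_sphere"
      and q: "q = slice_point i x y" and r: "r \<in> right_half_space \<inter> slice_plane j" for i j x y
  proof -
    obtain w where w: "r = slice_emb j w" using r by (auto simp: slice_plane_eq[OF j])
    let ?z = "Complex x y"
    have z: "q = slice_emb i ?z" by (simp add: q slice_point_eq_emb)
    have pos: "0 < Re w" "0 < Re ?z" "0 < Re (cnj ?z)"
      using assms by (simp_all add: w z slice_emb_half_space[OF i] slice_emb_half_space[OF j])
    have A: "slice_bergman_kernel right_half_space j (slice_point j x y) r = slice_emb j (1 / (pi * (?z + cnj w)\<^sup>2))"
      unfolding slice_point_eq_emb w by (rule slice_bergman_kernel_half_space[OF j pos(2,1)])
    have B: "slice_bergman_kernel right_half_space j (slice_point j x (- y)) r = slice_emb j (1 / (pi * (cnj ?z + cnj w)\<^sup>2))"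
      unfolding slice_point_eq_emb w complex_cnj[symmetric] by (rule slice_bergman_kernel_half_space[OF j pos(3,1)])
    show "?k i j x y = ?L" "?k i j x y = ?R"
      unfolding A B unfolding z w by (rule slice_kernel_extension[OF i j pos(2,1)])+
  qed
  obtain i z where i: "i \<in> imag_unit_sphere" and z: "q = slice_emb i z"
    by (rule exists_slice_emb)
  then have qi: "q = slice_point i (Re z) (Im z)" by (simp add: slice_emb_def)
  obtain j w where j: "j \<in> imag_unit_sphere" and w: "r = slice_emb j w"
    by (rule exists_slice_emb)
  then have rj: "r \<in> right_half_space \<inter> slice_plane j"
    using assms(2) by (simp add: slice_plane_eq[OF j])
  have "slice_bergman_kernel2 right_half_space q r = ?L"
    unfolding slice_bergman_kernel2_def
  proof (rule the_equality)
    show "\<forall>i\<in>imag_unit_sphere. \<forall>j\<in>imag_unit_sphere. \<forall>x y.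
        q = slice_point i x y \<longrightarrow> r \<in> right_half_space \<inter> slice_plane j \<longrightarrow> ?L = ?k i j x y"
      using k(1) by metis
  next
    fix k assume "\<forall>i\<in>imag_unit_sphere. \<forall>j\<in>imag_unit_sphere. \<forall>x y.
        q = slice_point i x y \<longrightarrow> r \<in> right_half_space \<inter> slice_plane j \<longrightarrow> k = ?k i j x y"
    then have "k = ?k i j (Re z) (Im z)"
      using i j qi rj by blast
    then show "k = ?L"
      using k(1)[OF i j qi rj] by simp
  qed
  \<comment> \<open>Both closed forms equal the value for one admissible choice, which exists by
    \<open>exists_slice_emb\<close>.\<close>
  moreover have "?L = ?R"
    using k[OF i j qi rj] by (rule trans[OF sym])
  ultimately show ?thesis by simp
qed

end
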